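(* Let $\zeta:\mathbb{R}\to\mathbb{R}$ satisfy $0<c<\zeta<C$ for some real constants $c<C$, and suppose there are $x_-<x_+$ such that $\zeta$ takes constant values $\zeta_-$ on $(-\infty,x_-)$ and $\zeta_+$ on $(x_+,\infty)$. Let $[a,b]\supset[x_-,x_+]$, let $n\geq1$ be an integer and let $T>0$. Given initial data $f,g$, let $$\alpha(x)=\tfrac12\Bigl(f(x)-\tfrac{1}{\zeta(x)}\int_{-\infty}^x\zeta(s)g(s)\,ds\Bigr),\qquad \beta(x)=\tfrac12\Bigl(f(x)+\tfrac{1}{\zeta(x)}\int_{-\infty}^x\zeta(s)g(s)\,ds\Bigr).$$ Let $\Delta$, $x_j$, $t_k$, $m$ and the step function $\zeta^P$ be as defined in the context. Let $u^P$ denote the solution to $$u_{tt}-\tfrac{1}{\zeta^P}(\zeta^Pu_x)_x=0,\qquad u(x,0)=f(x),\quad u_t(x,0)=g(x),$$ let $(x_j,t_k)$ be an arbitrary grid point ($1\leq j\leq n+1$, $0\leq k\leq m$), and let $\tilde u=(\tilde u^k_j)$ be the output of the scattering algorithm (defined in the context) with input $\zeta,\alpha,\beta,a,b,n,T$. 1. If $\alpha$ and $\beta$ are regular functions (as opposed to distributions), then $u^P(x_j,t_k)=\tilde u^k_j$. 2. If $\alpha(x)=\sum_{i\in\mathbb{Z}}c_i\,\delta(x-a-i\Delta)$ and $\beta(x)=\sum_{i\in\mathbb{Z}}d_i\,\delta(x-a-i\Delta)$ are Dirac combs supported on an extension of the spatial grid, and values of $\alpha$ and $\beta$ are replaced in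 the algorithm by the corresponding coefficients $c_i$ and $d_i$ (that is, $\alpha(a+i\Delta)$ by $c_i$ and $\beta(a+i\Delta)$ by $d_i$), then $u^P(x_j,t_k)=\tilde u^k_j\,\delta(x-x_j)$, where in this distributional case $u^P(x_j,t_k)$ stands for the part of the distribution $u^P(\cdot,t_k)$ located at the grid point $x_j$.
   Context: Grids and weights: $\Delta=(b-a)/n$; $x_j=a+(j-1)\Delta$ for $1\leq j\leq n+1$; $x_j^\ast=(x_j+x_{j+1})/2$ for $1\leq j\leq n$; $m=\lfloor T/\Delta\rfloor$; $t_k=k\Delta$ for $0\leq k\leq m$; and $r_j=\frac{\zeta(x_j)-\zeta(x_{j+1})}{\zeta(x_j)+\zeta(x_{j+1})}$ for $1\leq j\leq n$. Step function: $P=\{x_1,x_1^\ast,x_2,x_2^\ast,\ldots,x_n,x_n^\ast,x_{n+1}\}$, and $\zeta^P(x)=\zeta_-$ if $x<x_1^\ast$; $\zeta^P(x)=\zeta(x_j)$ if $x_{j-1}^\ast\leq x<x_j^\ast$ $(2\leq j\leq n)$; $\zeta^P(x)=\zeta_+$ if $x_n^\ast\leq x$. It is taken that $\zeta^P$ coincides with $\zeta$ on the spatial grid $x_1,\ldots,x_{n+1}$. Meaning of the solution $u^P$: on each of the intervals $(-\infty,x_1^\ast)$, $(x_{j-1}^\ast,x_j^\ast)$ $(2\leq j\leq n)$, $(x_n^\ast,\infty)$, where $\zeta^P$ is constant, the equation reduces to $u_{tt}-u_{xx}=0$ and the solution is a pair of left- and right-travelling waves. One-sided limits of $u$ and $\zeta^Pu_x$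 are required to agree at each jump point $x_j^\ast$. This yields reflection and transmission factors at $x_j^\ast$: a right-travelling wave is reflected with factor $r_j$ and transmitted with factor $1+r_j$; a left-travelling wave is reflected with factor $-r_j$ and transmitted with factor $1-r_j$. These laws are also given a valid interpretation for distributions. Scattering algorithm: initialize $$v^0_{2j-1}=\alpha(x_j),\quad v^0_{2j}=\beta(x_j),\quad \tilde u^0_j=v^0_{2j-1}+v^0_{2j}\quad(1\leq j\leq n+1),$$ $$v^k_1=\alpha(x_1-t_k),\quad v^k_{2n+2}=\beta(x_{n+1}+t_k)\quad(1\leq k\leq m).$$ Iterative step: given $v^k$ $(0\leq k\leq m-1)$, set $$v^{k+1}_{2j-1}=(1+r_{j-1})v^k_{2j-3}-r_{j-1}v^k_{2j}\quad(2\leq j\leq n+1),$$ $$v^{k+1}_{2j}=r_jv^k_{2j-1}+(1-r_j)v^k_{2j+2}\quad(1\leq j\leq n),$$ $$\tilde u^{k+1}_j=v^{k+1}_{2j-1}+v^{k+1}_{2j}\quad(1\leq j\leq n+1).$$ The output is $\tilde u=(\tilde u^k_j)$, $0\leq k\leq m$, $1\leq j\leq n+1$.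
   Formalization: As stated it fails, since α, β use ζ but u^P uses ζ^P. Proved: for u^P launched from α, β (parts 1, 2); for piecewise C^1 u^P with data f, g if α, β use ζ^P, or use ζ and the integrals of ζg and ζ^P g agree up to each x_j. *)

theory Defs
  imports "HOL-Analysis.Analysis"
begin

section \<open>Grids, reflection coefficients and the step function\<close>

text \<open>Grid points, layers and interfaces are numbered from 1: layer \<open>j\<close>
  (\<open>1 \<le> j \<le> n + 1\<close>) contains \<open>grid_pt a b n j\<close>, and \<open>mid_pt a b n j\<close>
  (\<open>1 \<le> j \<le> n\<close>) separates layer \<open>j\<close> from layer \<open>j + 1\<close>. The two outer layers are unbounded.\<close>

definition mesh :: "real \<Rightarrow> real \<Rightarrow> nat \<Rightarrow> real" where
  "mesh a b n = (b - a) / real n"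

definition grid_pt :: "real \<Rightarrow> real \<Rightarrow> nat \<Rightarrow> nat \<Rightarrow> real" where
  "grid_pt a b n j = a + (real j - 1) * mesh a b n"

definition mid_pt :: "real \<Rightarrow> real \<Rightarrow> nat \<Rightarrow> nat \<Rightarrow> real" where
  "mid_pt a b n j = (grid_pt a b n j + grid_pt a b n (j + 1)) / 2"

definition grid_time :: "real \<Rightarrow> real \<Rightarrow> nat \<Rightarrow> nat \<Rightarrow> real" where
  "grid_time a b n k = real k * mesh a b n"

definition num_steps :: "real \<Rightarrow> real \<Rightarrow> nat \<Rightarrow> real \<Rightarrow> nat" where
  "num_steps a b n T = nat \<lfloor>T / mesh a b n\<rfloor>"

definition refl_coef :: "(real \<Rightarrow> real) \<Rightarrow> real \<Rightarrow> real \<Rightarrow> nat \<Rightarrow> nat \<Rightarrow> real" where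
  "refl_coef \<zeta> a b n j =
     (\<zeta> (grid_pt a b n j) - \<zeta> (grid_pt a b n (j + 1))) /
     (\<zeta> (grid_pt a b n j) + \<zeta> (grid_pt a b n (j + 1)))"

definition step_impedance ::
  "(real \<Rightarrow> real) \<Rightarrow> real \<Rightarrow> real \<Rightarrow> real \<Rightarrow> real \<Rightarrow> nat \<Rightarrow> real \<Rightarrow> real" where
  "step_impedance \<zeta> \<zeta>m \<zeta>p a b n x =
     (if x < mid_pt a b n 1 then \<zeta>m
      else if mid_pt a b n n \<le> x then \<zeta>p
      else \<zeta> (grid_pt a b n
        (THE j. 2 \<le> j \<and> j \<le> n \<and> mid_pt a b n (j - 1) \<le> x \<and> x < mid_pt a b n j)))"

definition layer :: "real \<Rightarrow> real \<Rightarrow> nat \<Rightarrow> nat \<Rightarrow> real set" where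
  "layer a b n j = {x. (2 \<le> j \<longrightarrow> mid_pt a b n (j - 1) < x) \<and> (j \<le> n \<longrightarrow> x < mid_pt a b n j)}"

text \<open>The values taken by \<open>x - t\<close> (right-travelling waves) and by \<open>x + t\<close> (left-travelling waves)
  for \<open>x\<close> in layer \<open>j\<close> and \<open>t \<ge> 0\<close>.\<close>

definition right_dom :: "real \<Rightarrow> real \<Rightarrow> nat \<Rightarrow> nat \<Rightarrow> real set" where
  "right_dom a b n j = {\<xi>. j \<le> n \<longrightarrow> \<xi> < mid_pt a b n j}"

definition left_dom :: "real \<Rightarrow> real \<Rightarrow> nat \<Rightarrow> nat \<Rightarrow> real set" where
  "left_dom a b n j = {\<eta>. 2 \<le> j \<longrightarrow> mid_pt a b n (j - 1) < \<eta>}"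


section \<open>Right- and left-moving parts of the initial data\<close>

text \<open>The coefficient is a parameter because it matters which one is used: with a
  layerwise constant \<open>z\<close>, a solution of the initial value problem for \<open>z\<close> splits at
  time 0 into right- and left-travelling waves given by \<open>right_part z f g\<close> and
  \<open>left_part z f g\<close>. For a coefficient \<open>\<zeta>\<close> that agrees with \<open>z\<close> only at the grid points, the
  integrals of \<open>\<zeta> g\<close> and \<open>z g\<close>, and hence the two splittings, differ in general.
  The integral over \<open>{..x}\<close> is a Henstock-Kurzweil integral and so includes
  convergent improper integrals.\<close>

definition right_part ::
  "(real \<Rightarrow> real) \<Rightarrow> (real \<Rightarrow> real) \<Rightarrow> (real \<Rightarrow> real) \<Rightarrow> real \<Rightarrow> real" where
  "right_part \<zeta> f g x = (f x - 1 / \<zeta> x * integral {..x} (\<lambda>s. \<zeta> s * g s)) / 2"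

definition left_part ::
  "(real \<Rightarrow> real) \<Rightarrow> (real \<Rightarrow> real) \<Rightarrow> (real \<Rightarrow> real) \<Rightarrow> real \<Rightarrow> real" where
  "left_part \<zeta> f g x = (f x + 1 / \<zeta> x * integral {..x} (\<lambda>s. \<zeta> s * g s)) / 2"


section \<open>The scattering algorithm\<close>

fun scatter_v ::
  "(real \<Rightarrow> real) \<Rightarrow> (real \<Rightarrow> real) \<Rightarrow> (real \<Rightarrow> real) \<Rightarrow> real \<Rightarrow> real \<Rightarrow> nat \<Rightarrow> nat \<Rightarrow> nat \<Rightarrow> real" where
  "scatter_v \<zeta> \<alpha> \<beta> a b n 0 i =
     (if odd i then \<alpha> (grid_pt a b n ((i + 1) div 2)) else \<beta> (grid_pt a b n (i div 2)))"
| "scatter_v \<zeta> \<alpha> \<beta> a b n (Suc k) i =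
     (if i = 1 then \<alpha> (grid_pt a b n 1 - grid_time a b n (Suc k))
      else if i = 2 * n + 2 then \<beta> (grid_pt a b n (n + 1) + grid_time a b n (Suc k))
      else if odd i then
        (let j = (i + 1) div 2 in
          (1 + refl_coef \<zeta> a b n (j - 1)) * scatter_v \<zeta> \<alpha> \<beta> a b n k (2 * j - 3)
          - refl_coef \<zeta> a b n (j - 1) * scatter_v \<zeta> \<alpha> \<beta> a b n k (2 * j))
      else
        (let j = i div 2 in
          refl_coef \<zeta> a b n j * scatter_v \<zeta> \<alpha> \<beta> a b n k (2 * j - 1)
          + (1 - refl_coef \<zeta> a b n j) * scatter_v \<zeta> \<alpha> \<beta> a b n k (2 * j + 2)))"

definition scatter_u ::
  "(real \<Rightarrow> real) \<Rightarrow> (real \<Rightarrow> real) \<Rightarrow> (real \<Rightarrow> real) \<Rightarrow> real \<Rightarrow> real \<Rightarrow> nat \<Rightarrow> nat \<Rightarrow> nat \<Rightarrow> real" where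
  "scatter_u \<zeta> \<alpha> \<beta> a b n k j =
     scatter_v \<zeta> \<alpha> \<beta> a b n k (2 * j - 1) + scatter_v \<zeta> \<alpha> \<beta> a b n k (2 * j)"


section \<open>Solutions for a coefficient that is constant on each layer\<close>

text \<open>Throughout, \<open>z\<close> is constant on each layer, \<open>u x t\<close> is the solution at \<open>x\<close> and time
  \<open>t \<ge> 0\<close>, and \<open>p j\<close>, \<open>q j\<close> are the profiles of the right- and left-travelling wave
  in layer \<open>j\<close>.\<close>

definition wave_pair ::
  "real \<Rightarrow> real \<Rightarrow> nat \<Rightarrow> (nat \<Rightarrow> real \<Rightarrow> real) \<Rightarrow> (nat \<Rightarrow> real \<Rightarrow> real) \<Rightarrow>
   (real \<Rightarrow> real \<Rightarrow> real) \<Rightarrow> bool" where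
  "wave_pair a b n p q u \<longleftrightarrow>
     (\<forall>j\<in>{1..n+1}. \<forall>x\<in>layer a b n j. \<forall>t\<ge>0. u x t = p j (x - t) + q j (x + t))"

definition loc_piecewise_C1 :: "(real \<Rightarrow> real) \<Rightarrow> real set \<Rightarrow> bool" where
  "loc_piecewise_C1 h S \<longleftrightarrow> (\<forall>c d. {c..d} \<subseteq> S \<longrightarrow> h piecewise_C1_differentiable_on {c..d})"

text \<open>The initial value problem with data \<open>f\<close>, \<open>g\<close>, in the piecewise classical sense.
  Kinks in \<open>p j\<close>, \<open>q j\<close> have to be allowed even for smooth \<open>f\<close>, \<open>g\<close>: the condition on
  \<open>z u\<^sub>x\<close> typically fails at the interfaces at time 0, which creates kinks that travel
  along characteristics. Therefore \<open>u\<^sub>t = g\<close> is asked for off a locally finite set of points,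
  and the condition on \<open>z u\<^sub>x\<close> off a locally finite set of times.\<close>

definition ivp_solution ::
  "(real \<Rightarrow> real) \<Rightarrow> real \<Rightarrow> real \<Rightarrow> nat \<Rightarrow> (real \<Rightarrow> real) \<Rightarrow> (real \<Rightarrow> real) \<Rightarrow>
   (real \<Rightarrow> real \<Rightarrow> real) \<Rightarrow> bool" where
  "ivp_solution z a b n f g u \<longleftrightarrow>
     (\<exists>p q. wave_pair a b n p q u \<and>
        (\<forall>j\<in>{1..n+1}. loc_piecewise_C1 (p j) (closure (right_dom a b n j)) \<and>
                       loc_piecewise_C1 (q j) (closure (left_dom a b n j)))) \<and>
     (\<forall>x. u x 0 = f x) \<and>
     (\<forall>\<^sub>\<approx>x. ((\<lambda>t. u x t) has_real_derivative g x) (at 0 within {0..})) \<and>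
     (\<forall>j\<in>{1..n}. \<forall>t>0. \<exists>l.
        ((\<lambda>x. u x t) \<longlongrightarrow> l) (at_left (mid_pt a b n j)) \<and>
        ((\<lambda>x. u x t) \<longlongrightarrow> l) (at_right (mid_pt a b n j))) \<and>
     (\<forall>j\<in>{1..n}. \<forall>\<^sub>\<approx>t\<in>{0<..}. \<exists>l.
        ((\<lambda>x. z x * deriv (\<lambda>y. u y t) x) \<longlongrightarrow> l) (at_left (mid_pt a b n j)) \<and>
        ((\<lambda>x. z x * deriv (\<lambda>y. u y t) x) \<longlongrightarrow> l) (at_right (mid_pt a b n j)))"

text \<open>For initial waves \<open>\<alpha>\<close>, \<open>\<beta>\<close> without any regularity the interface conditions are
  expressed by the reflection and transmission laws. At time \<open>t\<close> the wave
  arriving at \<open>x\<^sup>* = mid_pt a b n j\<close> from the left is \<open>p j (x\<^sup>* - t)\<close> and the one arriving from the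
  right is \<open>q (j + 1) (x\<^sup>* + t)\<close>.\<close>

definition wave_solution ::
  "(real \<Rightarrow> real) \<Rightarrow> real \<Rightarrow> real \<Rightarrow> nat \<Rightarrow> (real \<Rightarrow> real) \<Rightarrow> (real \<Rightarrow> real) \<Rightarrow>
   (real \<Rightarrow> real \<Rightarrow> real) \<Rightarrow> bool" where
  "wave_solution z a b n \<alpha> \<beta> u \<longleftrightarrow>
     (\<exists>p q. wave_pair a b n p q u \<and>
        (\<forall>j\<in>{1..n+1}. \<forall>x\<in>layer a b n j. p j x = \<alpha> x \<and> q j x = \<beta> x) \<and>
        (\<forall>j\<in>{1..n}. \<forall>t>0.
           p (j + 1) (mid_pt a b n j - t) =
             (1 + refl_coef z a b n j) * p j (mid_pt a b n j - t)
             - refl_coef z a b n j * q (j + 1) (mid_pt a b n j + t) \<and>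
           q j (mid_pt a b n j + t) =
             refl_coef z a b n j * p j (mid_pt a b n j - t)
             + (1 - refl_coef z a b n j) * q (j + 1) (mid_pt a b n j + t)))"


section \<open>Distributions on the line\<close>

definition supp :: "(real \<Rightarrow> real) \<Rightarrow> real set" where
  "supp \<phi> = closure {x. \<phi> x \<noteq> 0}"

definition test_functions :: "real set \<Rightarrow> (real \<Rightarrow> real) set" where
  "test_functions \<Omega> =
     {\<phi>. (\<forall>k x. (deriv ^^ k) \<phi> field_differentiable at x) \<and> compact (supp \<phi>) \<and> supp \<phi> \<subseteq> \<Omega>}"

definition distribution_on :: "real set \<Rightarrow> ((real \<Rightarrow> real) \<Rightarrow> real) \<Rightarrow> bool" where
  "distribution_on \<Omega> U \<longleftrightarrow>
     (\<forall>\<phi>\<in>test_functions \<Omega>. \<forall>\<psi>\<in>test_functions \<Omega>. U (\<lambda>x. \<phi> x + \<psi> x) = U \<phi> + U \<psi>) \<and>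
     (\<forall>c. \<forall>\<phi>\<in>test_functions \<Omega>. U (\<lambda>x. c * \<phi> x) = c * U \<phi>) \<and>
     (\<forall>K. compact K \<and> K \<subseteq> \<Omega> \<longrightarrow>
        (\<exists>C N. \<forall>\<phi>\<in>test_functions K. \<bar>U \<phi>\<bar> \<le> C * (\<Sum>i\<le>N. SUP x. \<bar>(deriv ^^ i) \<phi> x\<bar>)))"

text \<open>The comb \<open>\<Sum>i. c i \<delta>(x - a - i h)\<close>; on a test function only finitely many terms
  are nonzero.\<close>

definition dirac_comb :: "(int \<Rightarrow> real) \<Rightarrow> real \<Rightarrow> real \<Rightarrow> (real \<Rightarrow> real) \<Rightarrow> real" where
  "dirac_comb c a h \<phi> = (\<Sum>\<^sub>\<infinity>i\<in>UNIV. c i * \<phi> (a + of_int i * h))"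

text \<open>The part of \<open>U\<close> located at \<open>y\<close> is \<open>c \<delta>(x - y)\<close>.\<close>

definition dirac_part_at :: "((real \<Rightarrow> real) \<Rightarrow> real) \<Rightarrow> real \<Rightarrow> real \<Rightarrow> bool" where
  "dirac_part_at U y c \<longleftrightarrow> (\<exists>\<epsilon>>0. \<forall>\<phi>\<in>test_functions (ball y \<epsilon>). U \<phi> = c * \<phi> y)"

text \<open>The distributional form of \<^const>\<open>wave_solution\<close>, with \<open>u t\<close> the distribution
  \<open>u(\<cdot>,t)\<close>. The waves \<open>p(x - t)\<close> and \<open>q(x + t)\<close> act on \<open>\<phi>\<close> by \<open>p (\<lambda>x. \<phi> (x + t))\<close> and
  \<open>q (\<lambda>x. \<phi> (x - t))\<close>. The scattering laws hold as distributions in \<open>t > 0\<close>, which is written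
  here in the variable \<open>x\<^sup>* - t < x\<^sup>*\<close> (first law) or \<open>x\<^sup>* + t > x\<^sup>*\<close> (second law), with
  \<open>x\<^sup>* = mid_pt a b n j\<close>; the reflection \<open>x \<mapsto> 2 x\<^sup>* - x\<close> exchanges these two variables.
  On the layers, \<open>u\<close> and \<open>u\<^sub>t\<close> have initial values \<open>\<alpha> + \<beta>\<close> and \<open>(\<beta> - \<alpha>)'\<close>.\<close>

definition wave_solution_dist ::
  "(real \<Rightarrow> real) \<Rightarrow> real \<Rightarrow> real \<Rightarrow> nat \<Rightarrow> ((real \<Rightarrow> real) \<Rightarrow> real) \<Rightarrow> ((real \<Rightarrow> real) \<Rightarrow> real) \<Rightarrow>
   (real \<Rightarrow> (real \<Rightarrow> real) \<Rightarrow> real) \<Rightarrow> bool" where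
  "wave_solution_dist z a b n \<alpha> \<beta> u \<longleftrightarrow>
     (\<forall>t\<ge>0. distribution_on UNIV (u t)) \<and>
     (\<exists>p q.
        (\<forall>j\<in>{1..n+1}. distribution_on (right_dom a b n j) (p j) \<and>
                       distribution_on (left_dom a b n j) (q j)) \<and>
        (\<forall>j\<in>{1..n+1}. \<forall>\<phi>\<in>test_functions (layer a b n j). \<forall>t\<ge>0.
           u t \<phi> = p j (\<lambda>x. \<phi> (x + t)) + q j (\<lambda>x. \<phi> (x - t))) \<and>
        (\<forall>j\<in>{1..n+1}. \<forall>\<phi>\<in>test_functions (layer a b n j). p j \<phi> = \<alpha> \<phi> \<and> q j \<phi> = \<beta> \<phi>) \<and>
        (\<forall>j\<in>{1..n}.
           (\<forall>\<phi>\<in>test_functions {..<mid_pt a b n j}.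
              p (j + 1) \<phi> =
                (1 + refl_coef z a b n j) * p j \<phi>
                - refl_coef z a b n j * q (j + 1) (\<lambda>x. \<phi> (2 * mid_pt a b n j - x))) \<and>
           (\<forall>\<phi>\<in>test_functions {mid_pt a b n j<..}.
              q j \<phi> =
                refl_coef z a b n j * p j (\<lambda>x. \<phi> (2 * mid_pt a b n j - x))
                + (1 - refl_coef z a b n j) * q (j + 1) \<phi>)))"

end

theory Submission
  imports Defs
begin

text \<open>In each layer a solution is a right-travelling wave \<open>p j (x - t)\<close> plus a left-travelling wave
  \<open>q j (x + t)\<close>. The interfaces lie halfway between grid points and the time step equals the
  mesh width \<open>h\<close>, so the right-travelling wave seen at grid point \<open>j + 1\<close> at time \<open>t + h\<close> left interface
  \<open>j\<close> at time \<open>t + h / 2\<close>. There it was composed, by the scattering law, of exactly two waves: the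
  right-travelling one that passed grid point \<open>j\<close> at time \<open>t\<close> and the left-travelling one that passed
  grid point \<open>j + 1\<close> at time \<open>t\<close>. This is one step of the algorithm, without any discretisation
  error, and induction on the number of steps gives \<open>wave_solution_at_grid\<close>. For Dirac combs the same
  induction runs on test functions supported within \<open>h / 2\<close> of a grid point: translations by
  multiples of \<open>h\<close> and reflections in interfaces map such functions to such functions
  (\<open>wave_solution_dist_at_grid\<close>).

  For the initial value problem, continuity of \<open>u\<close> and of \<open>z u\<^sub>x\<close> has to be turned into the
  scattering laws for the splitting of the data by \<open>z\<close> (\<open>ivp_solution_imp_wave_solution\<close>). The
  profiles in a layer are determined only up to a constant that may be moved from \<open>p j\<close> to \<open>q j\<close>.
  Since \<open>z (q j - p j)\<close> is a primitive of \<open>z g\<close> there, the constants can be chosen such that it equals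
  the integral of \<open>z g\<close> over \<open>{..x}\<close> in all layers at once; then it has no jump across an interface
  at time 0. Continuity of \<open>z u\<^sub>x\<close> says that the jump of \<open>z\<close> times the left-travelling minus the
  right-travelling wave has time derivative 0, so this jump vanishes at all times. Together with
  continuity of \<open>u\<close> this is a system of two linear equations for the two outgoing waves, and solving it
  gives the scattering laws.

  The step impedance and \<open>\<zeta>\<close> agree at the grid points and outside \<open>[a,b]\<close>, so they have the same reflection
  coefficients, and the two splittings of the data have the same values wherever the algorithm
  samples them, provided that the integrals agree at the grid points.\<close>

section \<open>The scattering recursion\<close>

lemma scatter_v_right_0: "1 \<le> j \<Longrightarrow> scatter_v z \<alpha> \<beta> a b n 0 (2 * j - 1) = \<alpha> (grid_pt a b n j)"
  by (auto elim!: evenE)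

lemma scatter_v_left_0: "scatter_v z \<alpha> \<beta> a b n 0 (2 * j) = \<beta> (grid_pt a b n j)"
  by simp

lemma scatter_v_right_boundary:
  "scatter_v z \<alpha> \<beta> a b n k 1 = \<alpha> (grid_pt a b n 1 - grid_time a b n k)"
  by (cases k) (simp_all add: grid_time_def)

lemma scatter_v_left_boundary:
  "scatter_v z \<alpha> \<beta> a b n k (2 * (n + 1)) = \<beta> (grid_pt a b n (n + 1) + grid_time a b n k)"
  by (cases k) (simp_all add: grid_time_def)

lemma scatter_v_right_Suc:
  assumes "1 \<le> j"
  shows "scatter_v z \<alpha> \<beta> a b n (Suc k) (2 * (j + 1) - 1) =
    (1 + refl_coef z a b n j) * scatter_v z \<alpha> \<beta> a b n k (2 * j - 1)
    - refl_coef z a b n j * scatter_v z \<alpha> \<beta> a b n k (2 * (j + 1))"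
proof -
  have "odd (2 * (j + 1) - 1)" "2 * (j + 1) - 1 \<noteq> 1" "2 * (j + 1) - 1 \<noteq> 2 * n + 2"
    and "(2 * (j + 1) - 1 + 1) div 2 = j + 1" "2 * (j + 1) - 3 = 2 * j - 1"
    using assms by presburger+
  then show ?thesis by (simp only: scatter_v.simps if_False if_True not_False_eq_True Let_def) simp
qed

lemma scatter_v_left_Suc:
  assumes "j \<le> n"
  shows "scatter_v z \<alpha> \<beta> a b n (Suc k) (2 * j) =
    refl_coef z a b n j * scatter_v z \<alpha> \<beta> a b n k (2 * j - 1)
    + (1 - refl_coef z a b n j) * scatter_v z \<alpha> \<beta> a b n k (2 * (j + 1))"
proof -
  have "\<not> odd (2 * j)" "2 * j \<noteq> 1" "2 * j \<noteq> 2 * n + 2" "2 * j div 2 = j"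
    using assms by presburger+
  then show ?thesis by (simp only: scatter_v.simps if_False if_True Let_def) simp
qed

text \<open>The recursion determines the right- and left-travelling waves \<open>P k j\<close> and \<open>Q k j\<close> at grid
  point \<open>j\<close> after \<open>k\<close> steps, so the algorithm can be compared with any other family that obeys it. The
  index \<open>j\<close> of the grid point replaces the parity of the index of \<^const>\<open>scatter_v\<close>.\<close>

lemma scatter_v_eqI:
  assumes "\<And>j. 1 \<le> j \<Longrightarrow> j \<le> n + 1 \<Longrightarrow> P 0 j = \<alpha> (grid_pt a b n j)"
    and "\<And>j. 1 \<le> j \<Longrightarrow> j \<le> n + 1 \<Longrightarrow> Q 0 j = \<beta> (grid_pt a b n j)"
    and "\<And>k. P k 1 = \<alpha> (grid_pt a b n 1 - grid_time a b n k)"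
    and "\<And>k. Q k (n + 1) = \<beta> (grid_pt a b n (n + 1) + grid_time a b n k)"
    and "\<And>k j. 1 \<le> j \<Longrightarrow> j \<le> n \<Longrightarrow> P (Suc k) (j + 1) =
           (1 + refl_coef z a b n j) * P k j - refl_coef z a b n j * Q k (j + 1)"
    and "\<And>k j. 1 \<le> j \<Longrightarrow> j \<le> n \<Longrightarrow> Q (Suc k) j =
           refl_coef z a b n j * P k j + (1 - refl_coef z a b n j) * Q k (j + 1)"
    and "1 \<le> j" "j \<le> n + 1"
  shows "scatter_v z \<alpha> \<beta> a b n k (2 * j - 1) = P k j \<and> scatter_v z \<alpha> \<beta> a b n k (2 * j) = Q k j"
  using assms(7,8)
proof (induction k arbitrary: j)
  case 0
  then show ?case using assms(1,2) by (simp only: scatter_v_right_0 scatter_v_left_0)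
next
  case (Suc k)
  have "scatter_v z \<alpha> \<beta> a b n (Suc k) (2 * j - 1) = P (Suc k) j"
  proof (cases "j = 1")
    case True
    then show ?thesis using assms(3)[of "Suc k"] scatter_v_right_boundary by simp
  next
    case False
    then obtain i where i: "j = i + 1" "1 \<le> i" "i \<le> n"
      using Suc.prems by (metis Nat.le_diff_conv2 add.commute le_add_diff_inverse le_antisym
          not_less_eq_eq One_nat_def Suc_eq_plus1 le_diff_conv)
    then show ?thesis using Suc.IH[of i] Suc.IH[of j] Suc.prems assms(5)[of i k]
      by (simp only: scatter_v_right_Suc)
  qed
  moreover have "scatter_v z \<alpha> \<beta> a b n (Suc k) (2 * j) = Q (Suc k) j"
  proof (cases "j = n + 1")
    case True
    then show ?thesis using assms(4)[of "Suc k"] scatter_v_left_boundary by simp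
  next
    case False
    then have j: "j \<le> n" using Suc.prems by simp
    then show ?thesis using Suc.IH[of j] Suc.IH[of "j + 1"] Suc.prems assms(6)[of j k]
      by (simp only: scatter_v_left_Suc)
  qed
  ultimately show ?case ..
qed

section \<open>Piecewise continuously differentiable functions\<close>

text \<open>Differentiability near \<open>x\<close> has to be part of the definition, because \<^const>\<open>deriv\<close> has an
  arbitrary value where the derivative does not exist.\<close>

definition C1_at :: "(real \<Rightarrow> real) \<Rightarrow> real \<Rightarrow> bool" where
  "C1_at h x \<longleftrightarrow> (\<forall>\<^sub>F y in nhds x. (h has_real_derivative deriv h y) (at y)) \<and> isCont (deriv h) x"

lemma C1_atD: "C1_at h x \<Longrightarrow> (h has_real_derivative deriv h x) (at x)"
  unfolding C1_at_def by (blast dest: eventually_nhds_x_imp_x)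

lemma piecewise_C1_imp_C1_at_except_finite:
  assumes "h piecewise_C1_differentiable_on {c..d}"
  obtains F where "finite F" "\<And>x. x \<in> {c<..<d} - F \<Longrightarrow> C1_at h x"
proof -
  from assms obtain F where F: "finite F" "h C1_differentiable_on ({c..d} - F)"
    unfolding piecewise_C1_differentiable_on_def by blast
  then obtain D where D: "\<And>x. x \<in> {c..d} - F \<Longrightarrow> (h has_real_derivative D x) (at x)"
    and cont: "continuous_on ({c..d} - F) D"
    unfolding C1_differentiable_on_def has_real_derivative_iff_has_vector_derivative by blast
  have op: "open ({c<..<d} - F)" using F(1) by (simp add: open_Diff finite_imp_closed)
  have "C1_at h x" if x: "x \<in> {c<..<d} - F" for x
  proof -
    have near: "\<forall>\<^sub>F y in nhds x. y \<in> {c<..<d} - F" using op x by (rule eventually_nhds_in_open)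
    have der: "(h has_real_derivative D y) (at y)" if "y \<in> {c<..<d} - F" for y
      using D that by simp
    have "continuous_on ({c<..<d} - F) D" by (rule continuous_on_subset[OF cont]) auto
    then have "isCont D x" using op x continuous_on_eq_continuous_at by blast
    moreover have ev: "\<forall>\<^sub>F y in nhds x. deriv h y = D y"
      using near by eventually_elim (use der DERIV_imp_deriv in blast)
    ultimately have "isCont (deriv h) x" using isCont_cong by blast
    moreover have "\<forall>\<^sub>F y in nhds x. (h has_real_derivative deriv h y) (at y)"
      using near ev by eventually_elim (use der in metis)
    ultimately show ?thesis unfolding C1_at_def by blast
  qed
  with F(1) show ?thesis using that by blast
qed

text \<open>The exceptional set may accumulate at 0, but it meets every \<open>[e, T]\<close> with \<open>e > 0\<close> in a finite
  set. So \<open>E\<close> is constant on these intervals, and continuity at 0 does the rest.\<close>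

lemma constant_if_deriv_zero_off_sparse:
  fixes E :: "real \<Rightarrow> real"
  assumes "0 < T" and S: "S sparse_in {0<..}" and cont: "continuous_on {0..T} E"
    and der: "\<And>t. 0 < t \<Longrightarrow> t < T \<Longrightarrow> t \<notin> S \<Longrightarrow> (E has_real_derivative 0) (at t)"
  shows "E T = E 0"
proof -
  have const: "E T = E e" if e: "0 < e" "e \<le> T" for e
  proof -
    have "finite ({e..T} \<inter> S)"
      using e by (intro sparse_in_compact_finite sparse_in_subset[OF S]) auto
    then have "((\<lambda>t. 0) has_integral (E T - E e)) {e..T}"
    proof (rule fundamental_theorem_of_calculus_interior_strong[OF _ e(2)])
      show "(E has_vector_derivative 0) (at x)" if "x \<in> {e<..<T} - {e..T} \<inter> S" for x
        using der[of x] that e by (auto simp: has_real_derivative_iff_has_vector_derivative)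
      show "continuous_on {e..T} E" using e by (intro continuous_on_subset[OF cont]) auto
    qed
    then show ?thesis using has_integral_unique[OF _ has_integral_0] by fastforce
  qed
  have "(E \<longlongrightarrow> E 0) (at 0 within {0..T})" using cont \<open>0 < T\<close> by (simp add: continuous_on_def)
  then have "(E \<longlongrightarrow> E 0) (at_right 0)"
    using \<open>0 < T\<close> by (simp add: at_within_Icc_at_right)
  moreover have "\<forall>\<^sub>F e in at_right 0. E e = E T"
    using eventually_at_right_real[OF \<open>0 < T\<close>] by eventually_elim (use const in auto)
  ultimately have "((\<lambda>e::real. E T) \<longlongrightarrow> E 0) (at_right 0)"
    by (rule Lim_transform_eventually)
  then show ?thesis by (simp add: tendsto_const_iff)
qed

section \<open>One-sided limits of a pair of waves\<close>

text \<open>The filter \<open>F\<close> stands for one of the one-sided neighbourhoods of an interface \<open>m\<close>, and \<open>S\<close> for the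
  layer on that side: \<open>U\<close> is a pair of waves on one side of \<open>m\<close> only.\<close>

lemma wave_pair_trace:
  fixes p q U :: "real \<Rightarrow> real"
  assumes "F \<le> at m" "\<forall>\<^sub>F x in F. x \<in> S" and U: "\<And>x. x \<in> S \<Longrightarrow> U x = p (x - t) + q (x + t)"
    and "isCont p (m - t)" "isCont q (m + t)"
  shows "(U \<longlongrightarrow> p (m - t) + q (m + t)) F"
proof -
  have "isCont (\<lambda>x. p (x - t)) m" "isCont (\<lambda>x. q (x + t)) m"
    using isCont_o2[of m "\<lambda>x. x - t" p] isCont_o2[of m "\<lambda>x. x + t" q] assms(4,5) by simp_all
  then have "((\<lambda>x. p (x - t) + q (x + t)) \<longlongrightarrow> p (m - t) + q (m + t)) (at m)"
    by (intro tendsto_add isContD)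
  then have "((\<lambda>x. p (x - t) + q (x + t)) \<longlongrightarrow> p (m - t) + q (m + t)) F"
    using assms(1) tendsto_mono by blast
  moreover have "\<forall>\<^sub>F x in F. p (x - t) + q (x + t) = U x"
    using assms(2) by eventually_elim (simp add: U)
  ultimately show ?thesis by (rule Lim_transform_eventually)
qed

text \<open>Openness of \<open>S\<close> makes \<open>deriv U\<close> at a point of \<open>S\<close> depend on the values of \<open>U\<close> in \<open>S\<close> only.\<close>

lemma wave_pair_flux_trace:
  fixes p q U z :: "real \<Rightarrow> real"
  assumes F: "F \<le> at m" and S: "\<forall>\<^sub>F x in F. x \<in> S" "open S"
    and U: "\<And>x. x \<in> S \<Longrightarrow> U x = p (x - t) + q (x + t)" and z: "\<And>x. x \<in> S \<Longrightarrow> z x = c"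
    and p: "C1_at p (m - t)" and q: "C1_at q (m + t)"
  shows "((\<lambda>x. z x * deriv U x) \<longlongrightarrow> c * (deriv p (m - t) + deriv q (m + t))) F"
proof -
  have "((\<lambda>x. deriv p (x - t) + deriv q (x + t)) \<longlongrightarrow> deriv p (m - t) + deriv q (m + t)) F"
    using p q unfolding C1_at_def by (intro wave_pair_trace[OF F S(1)]) auto
  then have lim: "((\<lambda>x. c * (deriv p (x - t) + deriv q (x + t))) \<longlongrightarrow>
      c * (deriv p (m - t) + deriv q (m + t))) F"
    by (rule tendsto_mult_left)
  have "filterlim (\<lambda>x. x - t) (nhds (m - t)) (nhds m)" "filterlim (\<lambda>x. x + t) (nhds (m + t)) (nhds m)"
    by (auto intro!: tendsto_intros filterlim_ident)
  then have "\<forall>\<^sub>F x in nhds m. (p has_real_derivative deriv p (x - t)) (at (x - t))"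
    "\<forall>\<^sub>F x in nhds m. (q has_real_derivative deriv q (x + t)) (at (x + t))"
    using p q unfolding C1_at_def filterlim_iff by blast+
  moreover have "F \<le> nhds m" using F at_within_le_nhds order_trans by blast
  ultimately have "\<forall>\<^sub>F x in F. (p has_real_derivative deriv p (x - t)) (at (x - t))"
    "\<forall>\<^sub>F x in F. (q has_real_derivative deriv q (x + t)) (at (x + t))"
    using filter_leD by blast+
  then have "\<forall>\<^sub>F x in F. c * (deriv p (x - t) + deriv q (x + t)) = z x * deriv U x"
    using S(1)
  proof eventually_elim
    case (elim x)
    have "((\<lambda>x. p (x - t)) has_real_derivative deriv p (x - t)) (at x)"
      using elim(1) DERIV_shift[of p "deriv p (x - t)" x "- t"] by simp
    moreover have "((\<lambda>x. q (x + t)) has_real_derivative deriv q (x + t)) (at x)"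
      using elim(2) DERIV_shift by blast
    ultimately have "((\<lambda>x. p (x - t) + q (x + t)) has_real_derivative
        deriv p (x - t) + deriv q (x + t)) (at x)"
      by (rule DERIV_add)
    then have "(U has_real_derivative deriv p (x - t) + deriv q (x + t)) (at x)"
      by (rule has_field_derivative_transform_within_open[OF _ S(2) elim(3)]) (simp add: U)
    then show ?case by (simp add: z[OF elim(3)] DERIV_imp_deriv)
  qed
  with lim show ?thesis by (rule Lim_transform_eventually)
qed

section \<open>Interface conditions for the wave profiles\<close>

lemma loc_piecewise_C1_subset: "loc_piecewise_C1 h S \<Longrightarrow> R \<subseteq> S \<Longrightarrow> loc_piecewise_C1 h R"
  unfolding loc_piecewise_C1_def by blast

lemma loc_piecewise_C1_continuous_on:
  assumes "loc_piecewise_C1 h S" "{c..d} \<subseteq> S" shows "continuous_on {c..d} h"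
  using assms unfolding loc_piecewise_C1_def piecewise_C1_differentiable_on_def by blast

lemma loc_piecewise_C1_isCont:
  assumes "loc_piecewise_C1 h S" "x \<in> interior S" shows "isCont h x"
proof -
  obtain e where e: "0 < e" "cball x e \<subseteq> S" using assms(2) by (auto simp: mem_interior_cball)
  then have "continuous_on {x - e..x + e} h"
    using loc_piecewise_C1_continuous_on[OF assms(1)] by (simp add: cball_eq_atLeastAtMost)
  then have "continuous_on {x - e<..<x + e} h" by (rule continuous_on_subset) auto
  then show ?thesis using e(1) by (simp add: continuous_on_eq_continuous_at)
qed

lemma DERIV_right_wave:
  fixes p :: "real \<Rightarrow> real"
  assumes "(p has_real_derivative D) (at (x - t))"
  shows "((\<lambda>t. p (x - t)) has_real_derivative - D) (at t)"
proof -
  have "((\<lambda>t. p (x - t)) has_real_derivative D * (- 1)) (at t)"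
    by (rule DERIV_chain2[where f = p and g = "\<lambda>t. x - t"])
      (use assms in \<open>auto intro!: derivative_eq_intros\<close>)
  then show ?thesis by simp
qed

lemma DERIV_left_wave:
  fixes q :: "real \<Rightarrow> real"
  assumes "(q has_real_derivative D) (at (x + t))"
  shows "((\<lambda>t. q (x + t)) has_real_derivative D) (at t)"
proof -
  have "((\<lambda>t. q (x + t)) has_real_derivative D * 1) (at t)"
    by (rule DERIV_chain2[where f = q and g = "\<lambda>t. x + t"])
      (use assms in \<open>auto intro!: derivative_eq_intros\<close>)
  then show ?thesis by simp
qed

text \<open>The time derivative of \<open>q (m + t) - p (m - t)\<close> is \<open>p' (m - t) + q' (m + t)\<close>, the \<open>x\<close>-derivative of the
  pair of waves at \<open>m\<close>. So the flux condition is an equation between time derivatives. It is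
  asked for only where all four profiles are continuously differentiable, which fails at finitely many
  times up to \<open>T\<close>.\<close>

lemma flux_balance_integrated:
  assumes p1: "loc_piecewise_C1 p1 {..m}" and p2: "loc_piecewise_C1 p2 {..m}"
    and q1: "loc_piecewise_C1 q1 {m..}" and q2: "loc_piecewise_C1 q2 {m..}"
    and flux: "\<forall>\<^sub>\<approx>t\<in>{0<..}.
      C1_at p1 (m - t) \<and> C1_at q1 (m + t) \<and> C1_at p2 (m - t) \<and> C1_at q2 (m + t) \<longrightarrow>
      z1 * (deriv p1 (m - t) + deriv q1 (m + t)) = z2 * (deriv p2 (m - t) + deriv q2 (m + t))"
    and T: "0 < T"
  shows "z1 * (q1 (m + T) - p1 (m - T)) - z2 * (q2 (m + T) - p2 (m - T)) =
         z1 * (q1 m - p1 m) - z2 * (q2 m - p2 m)"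
proof -
  define E where "E t = z1 * (q1 (m + t) - p1 (m - t)) - z2 * (q2 (m + t) - p2 (m - t))" for t
  have left: "{m - T..m} \<subseteq> {..m}" and right: "{m..m + T} \<subseteq> {m..}" by auto
  have "p1 piecewise_C1_differentiable_on {m - T..m}" "p2 piecewise_C1_differentiable_on {m - T..m}"
    "q1 piecewise_C1_differentiable_on {m..m + T}" "q2 piecewise_C1_differentiable_on {m..m + T}"
    using p1 p2 q1 q2 left right unfolding loc_piecewise_C1_def by blast+
  then obtain A B C D where fin: "finite A" "finite B" "finite C" "finite D"
    and A: "\<And>x. x \<in> {m - T<..<m} - A \<Longrightarrow> C1_at p1 x"
    and B: "\<And>x. x \<in> {m - T<..<m} - B \<Longrightarrow> C1_at p2 x"
    and C: "\<And>x. x \<in> {m<..<m + T} - C \<Longrightarrow> C1_at q1 x"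
    and D: "\<And>x. x \<in> {m<..<m + T} - D \<Longrightarrow> C1_at q2 x"
    by (metis piecewise_C1_imp_C1_at_except_finite)
  let ?bal = "\<lambda>t. C1_at p1 (m - t) \<and> C1_at q1 (m + t) \<and> C1_at p2 (m - t) \<and> C1_at q2 (m + t) \<longrightarrow>
      z1 * (deriv p1 (m - t) + deriv q1 (m + t)) = z2 * (deriv p2 (m - t) + deriv q2 (m + t))"
  \<comment> \<open>The times at which the flux condition fails or a kink of a profile passes \<open>m\<close>.\<close>
  define S where "S = {t. \<not> ?bal t} \<union> ((\<lambda>x. m - x) ` (A \<union> B) \<union> (\<lambda>x. x - m) ` (C \<union> D))"
  have "{t. \<not> ?bal t} sparse_in {0<..}" using flux by (simp only: eventually_cosparse)
  then have "S sparse_in {0<..}"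
    unfolding S_def by (rule sparse_in_union') (use fin in \<open>simp add: finite_imp_sparse\<close>)
  moreover have "continuous_on {0..T} E"
  proof -
    have cont: "continuous_on {m - T..m} p1" "continuous_on {m - T..m} p2"
      "continuous_on {m..m + T} q1" "continuous_on {m..m + T} q2"
      using p1 p2 q1 q2 left right by (auto intro: loc_piecewise_C1_continuous_on)
    show ?thesis unfolding E_def
      by (intro continuous_on_diff continuous_on_mult_left cont[THEN continuous_on_compose2])
        (auto intro!: continuous_intros)
  qed
  moreover have "(E has_real_derivative 0) (at t)" if t: "0 < t" "t < T" "t \<notin> S" for t
  proof -
    have "t \<notin> (\<lambda>x. m - x) ` (A \<union> B)" "t \<notin> (\<lambda>x. x - m) ` (C \<union> D)" and bal: "?bal t"
      using t(3) unfolding S_def by blast+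
    then have "m - t \<notin> A \<union> B" "m + t \<notin> C \<union> D"
      using image_eqI[of t "\<lambda>x. m - x" "m - t"] image_eqI[of t "\<lambda>x. x - m" "m + t"] by auto
    then have c1: "C1_at p1 (m - t)" "C1_at q1 (m + t)" "C1_at p2 (m - t)" "C1_at q2 (m + t)"
      using A B C D t by auto
    note dp = c1(1,3)[THEN C1_atD, THEN DERIV_right_wave]
      and dq = c1(2,4)[THEN C1_atD, THEN DERIV_left_wave]
    have "(E has_real_derivative
        z1 * (deriv q1 (m + t) - - deriv p1 (m - t)) -
        z2 * (deriv q2 (m + t) - - deriv p2 (m - t))) (at t)"
      unfolding E_def using dp dq by (intro DERIV_diff DERIV_cmult)
    then show ?thesis using bal c1 by (simp add: algebra_simps)
  qed
  ultimately have "E T = E 0" by (rule constant_if_deriv_zero_off_sparse[OF T])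
  then show ?thesis by (simp add: E_def)
qed

text \<open>Here \<open>p1\<close>, \<open>q2\<close> are the waves arriving at an interface and \<open>p2\<close>, \<open>q1\<close> those leaving it. Continuity of
  \<open>u\<close> and of the time integral of \<open>z u\<^sub>x\<close> are two linear equations, which are solved for \<open>p2\<close> and
  \<open>q1\<close>; \<open>z1 + z2 > 0\<close> makes the solution unique.\<close>

lemma scattering_laws_if_balance:
  fixes z1 z2 :: real
  assumes "0 < z1" "0 < z2" "r = (z1 - z2) / (z1 + z2)"
    and "p1 + q1 = p2 + q2" "z1 * (q1 - p1) = z2 * (q2 - p2)"
  shows "p2 = (1 + r) * p1 - r * q2 \<and> q1 = r * p1 + (1 - r) * q2"
proof -
  have r: "r * (z1 + z2) = z1 - z2" using assms(1-3) by simp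
  have "(z1 + z2) * p2 = (z1 + z2) * ((1 + r) * p1 - r * q2)"
    using assms(4,5) r by algebra
  then have "p2 = (1 + r) * p1 - r * q2" using assms(1,2) by simp
  moreover from this have "q1 = r * p1 + (1 - r) * q2" using assms(4) by (simp add: algebra_simps)
  ultimately show ?thesis by simp
qed

lemma one_sided_limits_agree:
  fixes f :: "real \<Rightarrow> real"
  assumes "\<exists>l. (f \<longlongrightarrow> l) (at_left m) \<and> (f \<longlongrightarrow> l) (at_right m)"
    and "(f \<longlongrightarrow> l1) (at_left m)" "(f \<longlongrightarrow> l2) (at_right m)"
  shows "l1 = l2"
  using assms tendsto_unique[OF trivial_limit_at_left_real]
    tendsto_unique[OF trivial_limit_at_right_real] by blast

section \<open>Waves in a layered medium\<close>

lemma has_integral_extend_right: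
  fixes f :: "real \<Rightarrow> real"
  assumes "(f has_integral i) {..c}" "(f has_integral j) {c..d}" "c \<le> d"
  shows "(f has_integral i + j) {..d}"
proof -
  have "{..c} \<inter> {c..d} = {c}" "{..c} \<union> {c..d} = {..d}" using assms(3) by auto
  then show ?thesis using has_integral_Un[OF assms(1,2)] by simp
qed

lemma integrable_on_extend_right:
  fixes f :: "real \<Rightarrow> real"
  assumes "f integrable_on {..c}" "f integrable_on {c..d}" "c \<le> d"
  shows "f integrable_on {..d}"
  using assms has_integral_extend_right unfolding integrable_on_def by blast

text \<open>What is used of the step impedance: a constant value on each layer, and positive values, so that
  the reflection coefficients are well defined.\<close>

locale layered_medium =
  fixes a b :: real and n :: nat and z :: "real \<Rightarrow> real"
  assumes a_less_b: "a < b" and n_pos: "1 \<le> n"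
    and z_layer: "1 \<le> j \<Longrightarrow> j \<le> n + 1 \<Longrightarrow> x \<in> layer a b n j \<Longrightarrow> z x = z (grid_pt a b n j)"
    and z_pos: "1 \<le> j \<Longrightarrow> j \<le> n + 1 \<Longrightarrow> 0 < z (grid_pt a b n j)"
begin

abbreviation "h \<equiv> mesh a b n"
abbreviation "X \<equiv> grid_pt a b n"
abbreviation "M \<equiv> mid_pt a b n"
abbreviation "\<tau> \<equiv> grid_time a b n"

lemma h_pos: "0 < h"
  using a_less_b n_pos by (simp add: mesh_def)

lemma X_Suc: "X (j + 1) = X j + h"
  by (simp add: grid_pt_def algebra_simps)

lemma X_1: "X 1 = a" and X_last: "X (n + 1) = b"
  using n_pos by (simp_all add: grid_pt_def mesh_def)

lemma M_eq: "M j = X j + h / 2"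
  by (simp add: mid_pt_def X_Suc del: One_nat_def Suc_eq_plus1 add_Suc_right)

lemma \<tau>_0: "\<tau> 0 = 0" and \<tau>_Suc: "\<tau> (Suc k) = \<tau> k + h" and \<tau>_nonneg: "0 \<le> \<tau> k"
  using h_pos by (simp_all add: grid_time_def algebra_simps)

lemma M_pred: "2 \<le> j \<Longrightarrow> M (j - 1) = X j - h / 2"
  using X_Suc[of "j - 1"] by (simp add: M_eq)

text \<open>Describing a layer by its grid point alone keeps the neighbouring indices out of the arithmetic.\<close>

lemma layer_eq:
  "layer a b n j = {x. (2 \<le> j \<longrightarrow> X j - h / 2 < x) \<and> (j \<le> n \<longrightarrow> x < X j + h / 2)}"
  by (cases "2 \<le> j") (simp_all add: layer_def M_pred M_eq[of j] del: One_nat_def)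

lemma open_layer: "open (layer a b n j)"
proof -
  have "layer a b n j = (if 2 \<le> j then {M (j - 1)<..} else UNIV) \<inter> (if j \<le> n then {..<M j} else UNIV)"
    by (auto simp: layer_def)
  then show ?thesis by (simp add: open_Int)
qed

lemma grid_pt_in_layer: "X j \<in> layer a b n j"
  using h_pos by (simp add: layer_eq)

lemma first_layer: "layer a b n 1 = {..<X 1 + h / 2}" and last_layer: "layer a b n (n + 1) = {X (n + 1) - h / 2<..}"
  using n_pos by (auto simp: layer_eq)

lemma closure_right_dom: "closure (right_dom a b n j) = {x. j \<le> n \<longrightarrow> x \<le> X j + h / 2}"
proof (cases "j \<le> n")
  case True
  then have "right_dom a b n j = {..<X j + h / 2}" by (auto simp: right_dom_def M_eq)
  then show ?thesis using True by auto
qed (simp add: right_dom_def)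

lemma closure_left_dom: "closure (left_dom a b n j) = {x. 2 \<le> j \<longrightarrow> X j - h / 2 \<le> x}"
proof (cases "2 \<le> j")
  case True
  then have "left_dom a b n j = {X j - h / 2<..}" by (auto simp: left_dom_def M_pred simp del: One_nat_def)
  then show ?thesis using True by auto
qed (simp add: left_dom_def)

text \<open>One step back in time along the two characteristics through a grid point leads to an interface
  after \<open>h / 2\<close> and from there to the grid points on both sides, so the scattering law at that interface,
  half a step after the old time, is the recursion of the algorithm. In the two outer layers one
  family of characteristics never meets an interface and leads back to the initial data.\<close>

lemma wave_solution_at_grid:
  assumes "wave_solution z a b n \<alpha> \<beta> u" and j: "1 \<le> j" "j \<le> n + 1"
  shows "u (X j) (\<tau> k) = scatter_u z \<alpha> \<beta> a b n k j"
proof -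
  from assms(1) obtain p q where wp: "wave_pair a b n p q u"
    and init: "\<And>j x. \<lbrakk>1 \<le> j; j \<le> n + 1; x \<in> layer a b n j\<rbrakk> \<Longrightarrow> p j x = \<alpha> x \<and> q j x = \<beta> x"
    and laws: "\<And>j t. \<lbrakk>1 \<le> j; j \<le> n; 0 < t\<rbrakk> \<Longrightarrow>
        p (j + 1) (M j - t) = (1 + refl_coef z a b n j) * p j (M j - t)
          - refl_coef z a b n j * q (j + 1) (M j + t) \<and>
        q j (M j + t) = refl_coef z a b n j * p j (M j - t)
          + (1 - refl_coef z a b n j) * q (j + 1) (M j + t)"
    unfolding wave_solution_def by (force simp del: One_nat_def)
  have step: "p (j + 1) (X (j + 1) - \<tau> (Suc k)) =
        (1 + refl_coef z a b n j) * p j (X j - \<tau> k) - refl_coef z a b n j * q (j + 1) (X (j + 1) + \<tau> k) \<and>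
      q j (X j + \<tau> (Suc k)) =
        refl_coef z a b n j * p j (X j - \<tau> k) + (1 - refl_coef z a b n j) * q (j + 1) (X (j + 1) + \<tau> k)"
    if "1 \<le> j" "j \<le> n" for j k
  proof -
    have "0 < \<tau> k + h / 2" using h_pos \<tau>_nonneg[of k] by simp
    moreover have "X (j + 1) - \<tau> (Suc k) = M j - (\<tau> k + h / 2)" "X j - \<tau> k = M j - (\<tau> k + h / 2)"
      "X (j + 1) + \<tau> k = M j + (\<tau> k + h / 2)" "X j + \<tau> (Suc k) = M j + (\<tau> k + h / 2)"
      unfolding X_Suc \<tau>_Suc M_eq by (simp_all add: field_simps)
    ultimately show ?thesis using laws[OF that] by presburger
  qed
  have "scatter_v z \<alpha> \<beta> a b n k (2 * j - 1) = p j (X j - \<tau> k) \<and>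
      scatter_v z \<alpha> \<beta> a b n k (2 * j) = q j (X j + \<tau> k)"
  proof (rule scatter_v_eqI[where P = "\<lambda>k j. p j (X j - \<tau> k)" and Q = "\<lambda>k j. q j (X j + \<tau> k)"])
    fix k
    have "0 \<le> \<tau> k" by (rule \<tau>_nonneg)
    then have "X 1 - \<tau> k \<in> layer a b n 1" "X (n + 1) + \<tau> k \<in> layer a b n (n + 1)"
      unfolding first_layer last_layer using h_pos by auto
    then show "p 1 (X 1 - \<tau> k) = \<alpha> (X 1 - \<tau> k)"
      "q (n + 1) (X (n + 1) + \<tau> k) = \<beta> (X (n + 1) + \<tau> k)"
      using init[of 1] init[of "n + 1"] n_pos by simp_all
  qed (use init grid_pt_in_layer step j in \<open>simp_all only: \<tau>_0 diff_zero add_0_right\<close>)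
  moreover have "u (X j) (\<tau> k) = p j (X j - \<tau> k) + q j (X j + \<tau> k)"
    using wp j grid_pt_in_layer \<tau>_nonneg unfolding wave_pair_def by simp
  ultimately show ?thesis by (simp add: scatter_u_def)
qed

text \<open>Both profiles of a layer are defined up to its end points, which carry the matching
  between neighbouring layers.\<close>

abbreviation "closed_layer j \<equiv> closure (right_dom a b n j) \<inter> closure (left_dom a b n j)"

text \<open>Differentiating the pair of waves at \<open>t = 0\<close> gives \<open>g = q' - p'\<close> off a finite set, so \<open>z (q - p)\<close> is a
  primitive of \<open>z g\<close> on the closed layer.\<close>

lemma velocity_has_integral:
  assumes wp: "wave_pair a b n p q u" and j: "1 \<le> j" "j \<le> n + 1"
    and p: "loc_piecewise_C1 (p j) (closure (right_dom a b n j))"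
    and q: "loc_piecewise_C1 (q j) (closure (left_dom a b n j))"
    and g: "\<forall>\<^sub>\<approx>x. ((\<lambda>t. u x t) has_real_derivative g x) (at 0 within {0..})"
    and cd: "c \<le> d" "{c..d} \<subseteq> closed_layer j"
  shows "((\<lambda>s. z s * g s) has_integral
           z (X j) * (q j d - p j d) - z (X j) * (q j c - p j c)) {c..d}"
proof -
  have "p j piecewise_C1_differentiable_on {c..d}" "q j piecewise_C1_differentiable_on {c..d}"
    using p q cd(2) unfolding loc_piecewise_C1_def by auto
  then obtain F H where fin: "finite F" "finite H"
    and F: "\<And>x. x \<in> {c<..<d} - F \<Longrightarrow> C1_at (p j) x"
    and H: "\<And>x. x \<in> {c<..<d} - H \<Longrightarrow> C1_at (q j) x"
    and cont: "continuous_on {c..d} (p j)" "continuous_on {c..d} (q j)"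
    by (metis piecewise_C1_imp_C1_at_except_finite piecewise_C1_differentiable_on_def)
  define K where "K = {x. \<not> ((\<lambda>t. u x t) has_real_derivative g x) (at 0 within {0..})}"
  have "K sparse_in UNIV" using g unfolding K_def by (simp only: eventually_cosparse)
  then have "finite ({c..d} \<inter> K)"
    by (intro sparse_in_compact_finite) (auto intro: sparse_in_subset)
  then have "finite (F \<union> H \<union> ({c..d} \<inter> K))" using fin by simp
  then show ?thesis
  proof (rule fundamental_theorem_of_calculus_interior_strong[OF _ cd(1)])
    show "continuous_on {c..d} (\<lambda>x. z (X j) * (q j x - p j x))"
      using cont by (intro continuous_intros)
    fix x assume x: "x \<in> {c<..<d} - (F \<union> H \<union> ({c..d} \<inter> K))"
    have "c \<in> closed_layer j" "d \<in> closed_layer j" using cd by auto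
    then have xl: "x \<in> layer a b n j"
      using x unfolding closure_right_dom closure_left_dom layer_eq by auto
    have dp: "(p j has_real_derivative deriv (p j) x) (at x)"
      and dq: "(q j has_real_derivative deriv (q j) x) (at x)"
      using x by (auto intro!: C1_atD F H)
    have "((\<lambda>t. p j (x - t) + q j (x + t)) has_real_derivative
        - deriv (p j) x + deriv (q j) x) (at 0)"
      using dp dq by (intro DERIV_add DERIV_right_wave DERIV_left_wave) simp_all
    then have "((\<lambda>t. p j (x - t) + q j (x + t)) has_real_derivative
        deriv (q j) x - deriv (p j) x) (at 0 within {0..})"
      by (simp add: has_field_derivative_at_within)
    then have "((\<lambda>t. u x t) has_real_derivative deriv (q j) x - deriv (p j) x) (at 0 within {0..})"
      by (rule has_field_derivative_transform_within[where d = 1])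
        (use wp j xl in \<open>auto simp: wave_pair_def\<close>)
    moreover have "((\<lambda>t. u x t) has_real_derivative g x) (at 0 within {0..})"
      using x unfolding K_def by auto
    ultimately have "g x = deriv (q j) x - deriv (p j) x"
      by (rule has_field_derivative_unique[THEN sym]) (simp add: at_within_Ici_at_right)
    moreover have "((\<lambda>x. z (X j) * (q j x - p j x)) has_real_derivative
        z (X j) * (deriv (q j) x - deriv (p j) x)) (at x)"
      by (intro DERIV_cmult DERIV_diff dp dq)
    ultimately show "((\<lambda>x. z (X j) * (q j x - p j x)) has_vector_derivative z x * g x) (at x)"
      using z_layer[OF j xl] by (simp add: has_real_derivative_iff_has_vector_derivative)
  qed
qed

text \<open>The half-line is exhausted layer by layer from the left.\<close>

lemma integrable_on_half_lines:
  fixes w :: "real \<Rightarrow> real"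
  assumes far_left: "\<And>x. x < a \<Longrightarrow> w integrable_on {..x}"
    and loc: "\<And>j c d. 1 \<le> j \<Longrightarrow> j \<le> n + 1 \<Longrightarrow> c \<le> d \<Longrightarrow> {c..d} \<subseteq> closed_layer j \<Longrightarrow>
               w integrable_on {c..d}"
  shows "w integrable_on {..x}"
proof -
  have "w integrable_on {..x}" if "1 \<le> j" "j \<le> n + 1" "x \<in> closure (right_dom a b n j)" for j x
    using that
  proof (induction j arbitrary: x rule: dec_induct)
    case base
    show ?case
    proof (cases "x < a")
      case False
      then have "w integrable_on {a - 1..x}"
        using base by (intro loc[of 1]) (auto simp: closure_right_dom closure_left_dom)
      then show ?thesis using False by (intro integrable_on_extend_right[OF far_left[of "a - 1"]]) auto
    qed (rule far_left)
  next
    case (step j)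
    have M: "X j + h / 2 = X (Suc j) - h / 2" using X_Suc[of j] by simp
    have IH: "w integrable_on {..y}" if "y \<le> X j + h / 2" for y
      using that step by (intro step.IH) (auto simp: closure_right_dom)
    show ?case
    proof (cases "x \<le> X j + h / 2")
      case False
      have "w integrable_on {X j + h / 2..x}"
        using False step by (intro loc[of "Suc j"]) (auto simp: closure_right_dom closure_left_dom M)
      then show ?thesis using False by (intro integrable_on_extend_right[OF IH]) auto
    qed (rule IH)
  qed
  from this[of "n + 1"] show ?thesis by (simp add: closure_right_dom)
qed

text \<open>This makes the integrals in \<open>right_part z\<close> and \<open>left_part z\<close> genuine ones: the integral
  of a function that is not integrable has the default value 0.\<close>

lemma ivp_solution_integrable:
  assumes ivp: "ivp_solution z a b n f g u"
    and far_left: "\<And>x. x < a \<Longrightarrow> (\<lambda>s. z s * g s) integrable_on {..x}"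
  shows "(\<lambda>s. z s * g s) integrable_on {..x}"
proof (rule integrable_on_half_lines[OF far_left])
  fix j c d assume j: "1 \<le> j" "j \<le> n + 1" and "c \<le> d" "{c..d} \<subseteq> closed_layer j"
  moreover obtain p q where "wave_pair a b n p q u"
    "\<forall>j\<in>{1..n+1}. loc_piecewise_C1 (p j) (closure (right_dom a b n j)) \<and>
       loc_piecewise_C1 (q j) (closure (left_dom a b n j))"
    "\<forall>\<^sub>\<approx>x. ((\<lambda>t. u x t) has_real_derivative g x) (at 0 within {0..})"
    using ivp unfolding ivp_solution_def by blast
  ultimately show "(\<lambda>s. z s * g s) integrable_on {c..d}"
    by (intro has_integral_integrable[OF velocity_has_integral[of p q u j]]) auto
qed

text \<open>The two matching conditions at an interface, translated from one-sided limits of \<open>u\<close> and \<open>z u\<^sub>x\<close>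
  into the profiles on the two sides. The second one is integrated over time, and so it relates
  time \<open>t\<close> to time 0.\<close>

lemma interface_jumps:
  assumes wp: "wave_pair a b n p q u" and j: "1 \<le> j" "j \<le> n"
    and reg: "\<forall>i\<in>{1..n+1}. loc_piecewise_C1 (p i) (closure (right_dom a b n i)) \<and>
                            loc_piecewise_C1 (q i) (closure (left_dom a b n i))"
    and cont: "\<forall>t>0. \<exists>l. ((\<lambda>x. u x t) \<longlongrightarrow> l) (at_left (M j)) \<and> ((\<lambda>x. u x t) \<longlongrightarrow> l) (at_right (M j))"
    and flux: "\<forall>\<^sub>\<approx>t\<in>{0<..}. \<exists>l.
        ((\<lambda>x. z x * deriv (\<lambda>y. u y t) x) \<longlongrightarrow> l) (at_left (M j)) \<and>
        ((\<lambda>x. z x * deriv (\<lambda>y. u y t) x) \<longlongrightarrow> l) (at_right (M j))"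
    and t: "0 < t"
  shows "p j (M j - t) + q j (M j + t) = p (j + 1) (M j - t) + q (j + 1) (M j + t)"
    and "z (X j) * (q j (M j + t) - p j (M j - t))
           - z (X (j + 1)) * (q (j + 1) (M j + t) - p (j + 1) (M j - t)) =
         z (X j) * (q j (M j) - p j (M j)) - z (X (j + 1)) * (q (j + 1) (M j) - p (j + 1) (M j))"
proof -
  let ?m = "M j"
  have j': "1 \<le> j + 1" "j + 1 \<le> n + 1" "j \<le> n + 1" using j by auto
  have Xj: "X j < ?m" "?m < X (j + 1)" and mj: "?m = X (j + 1) - h / 2" "?m = X j + h / 2"
    using h_pos unfolding M_eq X_Suc by auto
  have C1: "loc_piecewise_C1 (p j) {..?m}" "loc_piecewise_C1 (p (j + 1)) {..?m}"
    "loc_piecewise_C1 (q j) {?m..}" "loc_piecewise_C1 (q (j + 1)) {?m..}"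
  proof -
    have r: "loc_piecewise_C1 (p i) (closure (right_dom a b n i))"
      "loc_piecewise_C1 (q i) (closure (left_dom a b n i))" if "1 \<le> i" "i \<le> n + 1" for i
      using reg that by auto
    note pj = r(1)[OF j(1) j'(3)] r(1)[OF j'(1,2)] and qj = r(2)[OF j(1) j'(3)] r(2)[OF j'(1,2)]
    have "{..?m} \<subseteq> closure (right_dom a b n j)" "{..?m} \<subseteq> closure (right_dom a b n (j + 1))"
      "{?m..} \<subseteq> closure (left_dom a b n j)" "{?m..} \<subseteq> closure (left_dom a b n (j + 1))"
      using X_Suc[of j] h_pos by (auto simp: closure_right_dom closure_left_dom M_eq)
    then show "loc_piecewise_C1 (p j) {..?m}" "loc_piecewise_C1 (p (j + 1)) {..?m}"
      "loc_piecewise_C1 (q j) {?m..}" "loc_piecewise_C1 (q (j + 1)) {?m..}"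
      using pj qj loc_piecewise_C1_subset by blast+
  qed
  have evL: "\<forall>\<^sub>F x in at_left ?m. x \<in> layer a b n j"
    using eventually_at_left_real[OF Xj(1)]
    by eventually_elim (use h_pos in \<open>auto simp: layer_eq M_eq\<close>)
  have evR: "\<forall>\<^sub>F x in at_right ?m. x \<in> layer a b n (j + 1)"
    using eventually_at_right_real[OF Xj(2)]
    by eventually_elim (use h_pos mj in \<open>auto simp: layer_eq\<close>)
  have le: "at_left ?m \<le> at ?m" "at_right ?m \<le> at ?m" by (simp_all add: at_le)
  have uL: "u x s = p j (x - s) + q j (x + s)" if "0 \<le> s" "x \<in> layer a b n j" for x s
    using wp that j unfolding wave_pair_def by auto
  have uR: "u x s = p (j + 1) (x - s) + q (j + 1) (x + s)" if "0 \<le> s" "x \<in> layer a b n (j + 1)" for x s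
    using wp that j j' unfolding wave_pair_def by (metis atLeastAtMost_iff)
  show "p j (?m - t) + q j (?m + t) = p (j + 1) (?m - t) + q (j + 1) (?m + t)"
  proof -
    have "isCont (p j) (?m - t)" "isCont (p (j + 1)) (?m - t)"
      "isCont (q j) (?m + t)" "isCont (q (j + 1)) (?m + t)"
      using C1[THEN loc_piecewise_C1_isCont] t by auto
    then have "((\<lambda>x. u x t) \<longlongrightarrow> p j (?m - t) + q j (?m + t)) (at_left ?m)"
      "((\<lambda>x. u x t) \<longlongrightarrow> p (j + 1) (?m - t) + q (j + 1) (?m + t)) (at_right ?m)"
      using t uL uR by (intro wave_pair_trace[OF le(1) evL] wave_pair_trace[OF le(2) evR]; simp)+
    with cont[rule_format, OF t] show ?thesis by (rule one_sided_limits_agree)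
  qed
  show "z (X j) * (q j (?m + t) - p j (?m - t))
           - z (X (j + 1)) * (q (j + 1) (?m + t) - p (j + 1) (?m - t)) =
         z (X j) * (q j ?m - p j ?m) - z (X (j + 1)) * (q (j + 1) ?m - p (j + 1) ?m)"
  proof (rule flux_balance_integrated[OF C1 _ t])
    have "\<forall>\<^sub>\<approx>s\<in>{0<..}. s \<in> {0::real<..}" by (rule eventually_in_cosparse) simp_all
    with flux show "\<forall>\<^sub>\<approx>t\<in>{0<..}.
      C1_at (p j) (?m - t) \<and> C1_at (q j) (?m + t) \<and>
      C1_at (p (j + 1)) (?m - t) \<and> C1_at (q (j + 1)) (?m + t) \<longrightarrow>
      z (X j) * (deriv (p j) (?m - t) + deriv (q j) (?m + t)) =
      z (X (j + 1)) * (deriv (p (j + 1)) (?m - t) + deriv (q (j + 1)) (?m + t))"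
    proof eventually_elim
      case (elim s)
      then have s: "0 \<le> s" by simp
      show ?case
      proof (intro impI, elim conjE)
        assume c: "C1_at (p j) (?m - s)" "C1_at (q j) (?m + s)"
          "C1_at (p (j + 1)) (?m - s)" "C1_at (q (j + 1)) (?m + s)"
        have "((\<lambda>x. z x * deriv (\<lambda>y. u y s) x) \<longlongrightarrow>
            z (X j) * (deriv (p j) (?m - s) + deriv (q j) (?m + s))) (at_left ?m)"
          using uL[OF s] z_layer[OF j(1) j'(3)] c(1,2)
          by (rule wave_pair_flux_trace[OF le(1) evL open_layer])
        moreover have "((\<lambda>x. z x * deriv (\<lambda>y. u y s) x) \<longlongrightarrow>
            z (X (j + 1)) * (deriv (p (j + 1)) (?m - s) + deriv (q (j + 1)) (?m + s))) (at_right ?m)"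
          using uR[OF s] z_layer[OF j'(1,2)] c(3,4)
          by (rule wave_pair_flux_trace[OF le(2) evR open_layer])
        ultimately show "z (X j) * (deriv (p j) (?m - s) + deriv (q j) (?m + s)) =
            z (X (j + 1)) * (deriv (p (j + 1)) (?m - s) + deriv (q (j + 1)) (?m + s))"
          by (rule one_sided_limits_agree[OF elim(1)])
      qed
    qed
  qed
qed

text \<open>The profiles that witness an \<^const>\<open>ivp_solution\<close> may differ from the right- and left-moving parts of
  the data by opposite constants in each layer. After these are removed, \<open>z (q - p)\<close> is at time 0 the
  continuous function \<open>G\<close>, the integral of \<open>z g\<close>, so that it has no jump at the interfaces, and
  the integrated flux condition keeps it free of jumps.\<close>

lemma ivp_solution_imp_wave_solution:
  assumes ivp: "ivp_solution z a b n f g u"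
    and far_left: "\<And>x. x < a \<Longrightarrow> (\<lambda>s. z s * g s) integrable_on {..x}"
  shows "wave_solution z a b n (right_part z f g) (left_part z f g) u"
proof -
  from ivp obtain p q where wp: "wave_pair a b n p q u"
    and reg: "\<forall>j\<in>{1..n+1}. loc_piecewise_C1 (p j) (closure (right_dom a b n j)) \<and>
                            loc_piecewise_C1 (q j) (closure (left_dom a b n j))"
    unfolding ivp_solution_def by blast
  have init: "\<And>x. u x 0 = f x"
    and vel: "\<forall>\<^sub>\<approx>x. ((\<lambda>t. u x t) has_real_derivative g x) (at 0 within {0..})"
    using ivp unfolding ivp_solution_def by blast+
  define G where "G x = integral {..x} (\<lambda>s. z s * g s)" for x
  \<comment> \<open>By the velocity integral, \<open>G - z (q j - p j)\<close> has the same value \<open>C j\<close> all over layer \<open>j\<close>.\<close>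
  define C where "C j = G (X j) - z (X j) * (q j (X j) - p j (X j))" for j
  \<comment> \<open>Half of the constant goes to each profile, with opposite signs, so that \<open>u\<close> is unchanged.\<close>
  define p' where "p' j x = p j x - C j / (2 * z (X j))" for j x
  define q' where "q' j x = q j x + C j / (2 * z (X j))" for j x
  have G_diff: "G d - G c = z (X j) * (q j d - p j d) - z (X j) * (q j c - p j c)"
    if j: "1 \<le> j" "j \<le> n + 1" and "c \<le> d" "{c..d} \<subseteq> closed_layer j" for j c d
  proof -
    have "(\<lambda>s. z s * g s) integrable_on {..c}"
      using ivp far_left by (rule ivp_solution_integrable)
    then have "((\<lambda>s. z s * g s) has_integral G c) {..c}"
      unfolding G_def by (rule integrable_integral)
    moreover have "((\<lambda>s. z s * g s) has_integral
        z (X j) * (q j d - p j d) - z (X j) * (q j c - p j c)) {c..d}"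
      using reg j that(3,4) by (intro velocity_has_integral[OF wp j _ _ vel]) simp_all
    ultimately have "((\<lambda>s. z s * g s) has_integral
        G c + (z (X j) * (q j d - p j d) - z (X j) * (q j c - p j c))) {..d}"
      using that(3) by (rule has_integral_extend_right)
    then show ?thesis unfolding G_def by (simp add: integral_unique)
  qed
  have G_eq: "z (X j) * (q' j x - p' j x) = G x"
    if j: "1 \<le> j" "j \<le> n + 1" and x: "x \<in> closed_layer j" for j x
  proof -
    have Xc: "X j \<in> closed_layer j"
      using h_pos by (simp add: closure_right_dom closure_left_dom)
    have "{X j..x} \<subseteq> closed_layer j" "{x..X j} \<subseteq> closed_layer j"
      using Xc x by (auto simp: closure_right_dom closure_left_dom)
    then have "G x = z (X j) * (q j x - p j x) + C j"
      using G_diff[OF j, of "X j" x] G_diff[OF j, of x "X j"] unfolding C_def by fastforce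
    moreover have "q' j x - p' j x = q j x - p j x + C j / z (X j)"
      by (simp add: p'_def q'_def)
    ultimately show ?thesis using z_pos[OF j] by (simp add: distrib_left)
  qed
  have wp': "wave_pair a b n p' q' u"
    using wp unfolding wave_pair_def p'_def q'_def by simp
  have "p' j x = right_part z f g x \<and> q' j x = left_part z f g x"
    if j: "1 \<le> j" "j \<le> n + 1" and x: "x \<in> layer a b n j" for j x
  proof -
    have "x \<in> closed_layer j"
      using x unfolding closure_right_dom closure_left_dom layer_eq by auto
    then have "q' j x - p' j x = 1 / z x * G x"
      using G_eq[OF j] z_layer[OF j x] z_pos[OF j] by (simp add: field_simps)
    moreover have "p' j x + q' j x = f x"
      using wp' j x init[of x] unfolding wave_pair_def by force
    moreover have "v = (s - d) / 2 \<and> w = (s + d) / 2" if "w - v = d" "v + w = s" for v w s d :: real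
      using that by auto
    ultimately show ?thesis
      unfolding right_part_def left_part_def G_def[symmetric] by blast
  qed
  moreover have "p' (j + 1) (M j - t) =
        (1 + refl_coef z a b n j) * p' j (M j - t) - refl_coef z a b n j * q' (j + 1) (M j + t) \<and>
      q' j (M j + t) =
        refl_coef z a b n j * p' j (M j - t) + (1 - refl_coef z a b n j) * q' (j + 1) (M j + t)"
    if j: "1 \<le> j" "j \<le> n" and t: "0 < t" for j t
  proof (rule scattering_laws_if_balance)
    have j': "j \<le> n + 1" "1 \<le> j + 1" "j + 1 \<le> n + 1" using j by auto
    show pos: "0 < z (X j)" "0 < z (X (j + 1))" using z_pos j j' by blast+
    show "refl_coef z a b n j = (z (X j) - z (X (j + 1))) / (z (X j) + z (X (j + 1)))"
      by (simp add: refl_coef_def)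
    \<comment> \<open>The jump conditions hold for \<open>p\<close>, \<open>q\<close>, whose regularity is given; the constants are added afterwards.\<close>
    have jumps: "\<forall>t>0. \<exists>l. ((\<lambda>x. u x t) \<longlongrightarrow> l) (at_left (M j)) \<and> ((\<lambda>x. u x t) \<longlongrightarrow> l) (at_right (M j))"
      "\<forall>\<^sub>\<approx>t\<in>{0<..}. \<exists>l.
        ((\<lambda>x. z x * deriv (\<lambda>y. u y t) x) \<longlongrightarrow> l) (at_left (M j)) \<and>
        ((\<lambda>x. z x * deriv (\<lambda>y. u y t) x) \<longlongrightarrow> l) (at_right (M j))"
      using ivp j unfolding ivp_solution_def by auto
    note jump = interface_jumps[OF wp j reg jumps t]
    show "p' j (M j - t) + q' j (M j + t) = p' (j + 1) (M j - t) + q' (j + 1) (M j + t)"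
      using jump(1) by (simp add: p'_def q'_def)
    have "M j \<in> closed_layer j" "M j \<in> closed_layer (j + 1)"
      using h_pos X_Suc[of j] by (auto simp: closure_right_dom closure_left_dom M_eq)
    then have "z (X j) * (q' j (M j) - p' j (M j)) = z (X (j + 1)) * (q' (j + 1) (M j) - p' (j + 1) (M j))"
      using G_eq j j' by metis
    moreover have "z (X i) * (q' i y - p' i x) = z (X i) * (q i y - p i x) + C i"
      if "i = j \<or> i = j + 1" for i x y
      using that pos by (auto simp: p'_def q'_def field_simps)
    ultimately show "z (X j) * (q' j (M j + t) - p' j (M j - t)) =
        z (X (j + 1)) * (q' (j + 1) (M j + t) - p' (j + 1) (M j - t))"
      using jump(2) by (simp del: Suc_eq_plus1 add: Suc_eq_plus1[symmetric])
  qed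
  ultimately show ?thesis
    unfolding wave_solution_def using wp' by (metis atLeastAtMost_iff)
qed

end
section \<open>Dirac combs\<close>

lemma deriv_iterate_affine:
  fixes \<phi> :: "real \<Rightarrow> real"
  assumes "\<And>k x. (deriv ^^ k) \<phi> field_differentiable at x"
  shows "(deriv ^^ k) (\<lambda>x. \<phi> (\<sigma> * x + s)) = (\<lambda>x. \<sigma> ^ k * (deriv ^^ k) \<phi> (\<sigma> * x + s))"
    and "(deriv ^^ k) (\<lambda>x. \<phi> (\<sigma> * x + s)) field_differentiable at x"
proof -
  have der: "((\<lambda>x. \<sigma> ^ k * (deriv ^^ k) \<phi> (\<sigma> * x + s)) has_real_derivative
      \<sigma> ^ Suc k * (deriv ^^ Suc k) \<phi> (\<sigma> * x + s)) (at x)" for k x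
  proof -
    have "((deriv ^^ k) \<phi> has_real_derivative (deriv ^^ Suc k) \<phi> (\<sigma> * x + s)) (at (\<sigma> * x + s))"
      using assms by (simp add: field_differentiable_derivI)
    then have "((\<lambda>x. (deriv ^^ k) \<phi> (\<sigma> * x + s)) has_real_derivative
        (deriv ^^ Suc k) \<phi> (\<sigma> * x + s) * \<sigma>) (at x)"
      by (rule DERIV_chain2[where g = "\<lambda>x. \<sigma> * x + s"]) (auto intro!: derivative_eq_intros)
    from DERIV_cmult[OF this, of "\<sigma> ^ k"] show ?thesis by (simp add: mult_ac)
  qed
  show eq: "(deriv ^^ k) (\<lambda>x. \<phi> (\<sigma> * x + s)) = (\<lambda>x. \<sigma> ^ k * (deriv ^^ k) \<phi> (\<sigma> * x + s))"
  proof (induction k)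
    case (Suc k)
    then have "(deriv ^^ Suc k) (\<lambda>x. \<phi> (\<sigma> * x + s)) =
        deriv (\<lambda>x. \<sigma> ^ k * (deriv ^^ k) \<phi> (\<sigma> * x + s))" by simp
    also have "\<dots> = (\<lambda>x. \<sigma> ^ Suc k * (deriv ^^ Suc k) \<phi> (\<sigma> * x + s))"
      by (rule ext, rule DERIV_imp_deriv, rule der)
    finally show ?case .
  qed simp
  show "(deriv ^^ k) (\<lambda>x. \<phi> (\<sigma> * x + s)) field_differentiable at x"
    unfolding eq using der field_differentiable_def by blast
qed

text \<open>Translations and reflections, by which waves move and are reflected, are the cases
  \<open>\<sigma> = 1\<close> and \<open>\<sigma> = -1\<close>.\<close>

lemma test_functions_affine:
  assumes \<phi>: "\<phi> \<in> test_functions \<Omega>" and "\<sigma> \<noteq> 0" and \<Omega>: "\<And>y. y \<in> \<Omega> \<Longrightarrow> (y - s) / \<sigma> \<in> \<Omega>'"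
  shows "(\<lambda>x. \<phi> (\<sigma> * x + s)) \<in> test_functions \<Omega>'"
proof -
  let ?\<psi> = "\<lambda>x. \<phi> (\<sigma> * x + s)" and ?K = "(\<lambda>y. (y - s) / \<sigma>) ` supp \<phi>"
  have supp: "compact (supp \<phi>)" "supp \<phi> \<subseteq> \<Omega>" using \<phi> by (auto simp: test_functions_def)
  have K: "compact ?K" using supp(1) \<open>\<sigma> \<noteq> 0\<close> by (intro compact_continuous_image continuous_intros) auto
  have "{x. ?\<psi> x \<noteq> 0} \<subseteq> ?K"
  proof
    fix x assume "x \<in> {x. ?\<psi> x \<noteq> 0}"
    then have "\<sigma> * x + s \<in> supp \<phi>" unfolding supp_def using closure_subset by force
    moreover have "x = (\<sigma> * x + s - s) / \<sigma>" using \<open>\<sigma> \<noteq> 0\<close> by simp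
    ultimately show "x \<in> ?K" by (rule rev_image_eqI)
  qed
  then have "supp ?\<psi> \<subseteq> ?K"
    using closure_minimal[OF _ compact_imp_closed[OF K]] by (simp only: supp_def[of ?\<psi>])
  moreover from this have "compact (supp ?\<psi>)"
    using K by (metis supp_def closed_closure compact_Int_closed inf.absorb_iff2)
  ultimately show ?thesis
    using deriv_iterate_affine(2) \<phi> supp(2) \<Omega> unfolding test_functions_def by fastforce
qed

lemma test_functions_mono: "\<phi> \<in> test_functions \<Omega> \<Longrightarrow> \<Omega> \<subseteq> \<Omega>' \<Longrightarrow> \<phi> \<in> test_functions \<Omega>'"
  unfolding test_functions_def by blast

lemma test_functions_shift:
  assumes "\<phi> \<in> test_functions (ball y r)"
  shows "(\<lambda>x. \<phi> (x + s)) \<in> test_functions (ball (y - s) r)"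
  using test_functions_affine[OF assms, of 1 s "ball (y - s) r"] by (simp add: dist_real_def)

lemma test_functions_reflect:
  assumes "\<phi> \<in> test_functions (ball y r)"
  shows "(\<lambda>x. \<phi> (s - x)) \<in> test_functions (ball (s - y) r)"
  using test_functions_affine[OF assms, of "-1" s "ball (s - y) r"]
  by (simp add: dist_real_def abs_minus_commute)

text \<open>The points of the comb are \<open>h\<close> apart, so only one of them meets a ball of radius \<open>h / 2\<close> around one
  of them.\<close>

lemma dirac_comb_test_function:
  assumes "0 < h" and \<phi>: "\<phi> \<in> test_functions (ball (a + of_int i * h) (h / 2))"
  shows "dirac_comb c a h \<phi> = c i * \<phi> (a + of_int i * h)"
proof -
  have "\<phi> (a + of_int l * h) = 0" if "l \<noteq> i" for l
  proof (rule ccontr)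
    assume "\<phi> (a + of_int l * h) \<noteq> 0"
    then have "a + of_int l * h \<in> supp \<phi>" unfolding supp_def using closure_subset by force
    then have "\<bar>of_int i * h - of_int l * h\<bar> < h / 2"
      using \<phi> by (auto simp: test_functions_def dist_real_def)
    moreover have "\<bar>of_int i * h - of_int l * h\<bar> = of_int \<bar>i - l\<bar> * h"
      using \<open>0 < h\<close> by (simp add: abs_mult left_diff_distrib[symmetric])
    moreover have "1 * h \<le> of_int \<bar>i - l\<bar> * h"
      using \<open>0 < h\<close> that by (intro mult_right_mono) auto
    ultimately show False using \<open>0 < h\<close> by simp
  qed
  then have "dirac_comb c a h \<phi> = (\<Sum>\<^sub>\<infinity>l\<in>{i}. c l * \<phi> (a + of_int l * h))"
    unfolding dirac_comb_def by (intro infsum_cong_neutral) auto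
  then show ?thesis by simp
qed

context layered_medium
begin

lemma dirac_comb_near_grid_pt:
  assumes A: "\<And>i. A (a + of_int i * h) = c i" and \<phi>: "\<phi> \<in> test_functions (ball y (h / 2))"
    and y: "y = a + of_int i * h"
  shows "dirac_comb c a h \<phi> = A y * \<phi> y"
  using dirac_comb_test_function[OF h_pos, of \<phi> a i c] assms by simp

text \<open>The induction of \<open>wave_solution_at_grid\<close>, with the point evaluation at a grid point replaced by test
  functions supported in the ball of radius \<open>h / 2\<close> around it. This radius is the distance to the
  interfaces: the supports, moved back along the characteristics by one step, lie on the side of the
  interface where the scattering law applies. The multiple of \<open>\<phi> (X j)\<close> by which such a wave acts
  is the coefficient computed by the algorithm.\<close>

lemma wave_solution_dist_at_grid:
  assumes sol: "wave_solution_dist z a b n (dirac_comb c a h) (dirac_comb d a h) u"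
    and A: "\<And>i. A (a + of_int i * h) = c i" and B: "\<And>i. B (a + of_int i * h) = d i"
    and j: "1 \<le> j" "j \<le> n + 1"
  shows "dirac_part_at (u (\<tau> k)) (X j) (scatter_u z A B a b n k j)"
proof -
  let ?D = "\<lambda>y. test_functions (ball y (h / 2))"
  from sol obtain p q where
    up: "\<And>j \<phi> t. \<lbrakk>1 \<le> j; j \<le> n + 1; \<phi> \<in> test_functions (layer a b n j); 0 \<le> t\<rbrakk> \<Longrightarrow>
        u t \<phi> = p j (\<lambda>x. \<phi> (x + t)) + q j (\<lambda>x. \<phi> (x - t))"
    and init: "\<And>j \<phi>. \<lbrakk>1 \<le> j; j \<le> n + 1; \<phi> \<in> test_functions (layer a b n j)\<rbrakk> \<Longrightarrow>
        p j \<phi> = dirac_comb c a h \<phi> \<and> q j \<phi> = dirac_comb d a h \<phi>"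
    and law_p: "\<And>j \<phi>. \<lbrakk>1 \<le> j; j \<le> n; \<phi> \<in> test_functions {..<M j}\<rbrakk> \<Longrightarrow>
        p (j + 1) \<phi> = (1 + refl_coef z a b n j) * p j \<phi>
          - refl_coef z a b n j * q (j + 1) (\<lambda>x. \<phi> (2 * M j - x))"
    and law_q: "\<And>j \<phi>. \<lbrakk>1 \<le> j; j \<le> n; \<phi> \<in> test_functions {M j<..}\<rbrakk> \<Longrightarrow>
        q j \<phi> = refl_coef z a b n j * p j (\<lambda>x. \<phi> (2 * M j - x))
          + (1 - refl_coef z a b n j) * q (j + 1) \<phi>"
    unfolding wave_solution_dist_def by (force simp del: One_nat_def)
  have ball_layer: "ball (X j) (h / 2) \<subseteq> layer a b n j" for j
    by (auto simp: layer_eq ball_eq_greaterThanLessThan)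
  have waves: "p j (\<lambda>x. \<phi> (x + \<tau> k)) = scatter_v z A B a b n k (2 * j - 1) * \<phi> (X j) \<and>
      q j (\<lambda>x. \<phi> (x - \<tau> k)) = scatter_v z A B a b n k (2 * j) * \<phi> (X j)"
    if "1 \<le> j" "j \<le> n + 1" "\<phi> \<in> ?D (X j)" for j k \<phi>
    using that
  proof (induction k arbitrary: j \<phi>)
    case 0
    have X: "X j = a + of_int (int j - 1) * h" by (simp add: grid_pt_def)
    have "\<phi> \<in> test_functions (layer a b n j)"
      using 0(3) ball_layer by (rule test_functions_mono)
    then have "p j \<phi> = A (X j) * \<phi> (X j)" "q j \<phi> = B (X j) * \<phi> (X j)"
      using init 0 dirac_comb_near_grid_pt[where A = A and c = c, OF A 0(3) X] dirac_comb_near_grid_pt[where A = B and c = d, OF B 0(3) X] by auto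
    then show ?case
      using 0(1) by (simp only: \<tau>_0 add_0_right diff_zero scatter_v_right_0 scatter_v_left_0)
  next
    case (Suc k)
    let ?r = "\<lambda>j. refl_coef z a b n j" and ?v = "scatter_v z A B a b n k"
    let ?t = "\<tau> (Suc k)"
    note pIH = Suc.IH[THEN conjunct1] and qIH = Suc.IH[THEN conjunct2]
    have D_right: "(\<lambda>x. \<phi> (x + ?t)) \<in> ?D (X j - ?t)" and D_left: "(\<lambda>x. \<phi> (x - ?t)) \<in> ?D (X j + ?t)"
      using test_functions_shift[OF Suc.prems(3), of ?t] test_functions_shift[OF Suc.prems(3), of "- ?t"]
      by simp_all
    have "p j (\<lambda>x. \<phi> (x + ?t)) = scatter_v z A B a b n (Suc k) (2 * j - 1) * \<phi> (X j)"
    proof (cases "j = 1")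
      case True
      have "ball (X 1 - ?t) (h / 2) \<subseteq> layer a b n 1"
        unfolding first_layer using \<tau>_nonneg[of "Suc k"] by (auto simp: ball_eq_greaterThanLessThan)
      then have "p 1 (\<lambda>x. \<phi> (x + ?t)) = dirac_comb c a h (\<lambda>x. \<phi> (x + ?t))"
        using init[of 1] D_right True n_pos test_functions_mono by simp
      moreover have y: "X 1 - ?t = a + of_int (- int (Suc k)) * h"
        by (simp add: grid_pt_def grid_time_def algebra_simps)
      moreover have "dirac_comb c a h (\<lambda>x. \<phi> (x + ?t)) = A (X 1 - ?t) * \<phi> (X 1)"
        using dirac_comb_near_grid_pt[where A = A and c = c, OF A D_right[unfolded True] y] by simp
      ultimately show ?thesis using True scatter_v_right_boundary by simp
    next
      case False
      then have "\<exists>i\<ge>1. i \<le> n \<and> j = i + 1" using Suc.prems by (intro exI[of _ "j - 1"]) auto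
      then obtain i where i: "1 \<le> i" "i \<le> n" "j = i + 1" by blast
      have Xj: "X j = X i + h" and M: "M i = X j - h / 2" using X_Suc[of i] i(3) by (simp_all add: M_eq)
      have "ball (X j - ?t) (h / 2) \<subseteq> {..<M i}"
        using \<tau>_nonneg[of k] by (auto simp: \<tau>_Suc M ball_eq_greaterThanLessThan)
      then have "p j (\<lambda>x. \<phi> (x + ?t)) = (1 + ?r i) * p i (\<lambda>x. \<phi> (x + ?t))
          - ?r i * q j (\<lambda>x. \<phi> (2 * M i - x + ?t))"
        using law_p[OF i(1,2)] D_right test_functions_mono unfolding i(3) by blast
      also have "p i (\<lambda>x. \<phi> (x + ?t)) = ?v (2 * i - 1) * \<phi> (X j)"
      proof -
        have "(\<lambda>x. \<phi> (x + h)) \<in> ?D (X i)"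
          using test_functions_shift[OF Suc.prems(3), of h] by (simp add: Xj)
        from pIH[OF i(1) _ this] show ?thesis using i(2) by (simp add: \<tau>_Suc Xj add.assoc)
      qed
      \<comment> \<open>Reflection in the interface followed by a shift by \<open>h\<close> is reflection in the grid point,
        which preserves the ball around it and the value at it.\<close>
      also have "q j (\<lambda>x. \<phi> (2 * M i - x + ?t)) = ?v (2 * j) * \<phi> (X j)"
      proof -
        have "(\<lambda>x. \<phi> (2 * X j - x)) \<in> ?D (X j)"
          using test_functions_reflect[OF Suc.prems(3), of "2 * X j"] by simp
        from qIH[OF Suc.prems(1,2) this] show ?thesis
          by (simp add: \<tau>_Suc M algebra_simps)
      qed
      finally show ?thesis
        unfolding i(3) scatter_v_right_Suc[OF i(1)] by (simp only: left_diff_distrib mult.assoc)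
    qed
    moreover have "q j (\<lambda>x. \<phi> (x - ?t)) = scatter_v z A B a b n (Suc k) (2 * j) * \<phi> (X j)"
    proof (cases "j = n + 1")
      case True
      have "ball (X (n + 1) + ?t) (h / 2) \<subseteq> layer a b n (n + 1)"
        unfolding last_layer using \<tau>_nonneg[of "Suc k"] by (auto simp: ball_eq_greaterThanLessThan)
      then have "q (n + 1) (\<lambda>x. \<phi> (x - ?t)) = dirac_comb d a h (\<lambda>x. \<phi> (x - ?t))"
        using init[of "n + 1"] D_left True n_pos test_functions_mono by simp
      moreover have y: "X (n + 1) + ?t = a + of_int (int (n + Suc k)) * h"
        by (simp add: grid_pt_def grid_time_def algebra_simps)
      moreover have "dirac_comb d a h (\<lambda>x. \<phi> (x - ?t)) = B (X (n + 1) + ?t) * \<phi> (X (n + 1))"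
        using dirac_comb_near_grid_pt[where A = B and c = d, OF B D_left[unfolded True] y] by simp
      ultimately show ?thesis using True scatter_v_left_boundary by simp
    next
      case False
      then have jn: "j \<le> n" "j + 1 \<le> n + 1" "1 \<le> j + 1" using Suc.prems by simp_all
      have "ball (X j + ?t) (h / 2) \<subseteq> {M j<..}"
        using \<tau>_nonneg[of k] by (auto simp: \<tau>_Suc M_eq ball_eq_greaterThanLessThan)
      then have "q j (\<lambda>x. \<phi> (x - ?t)) = ?r j * p j (\<lambda>x. \<phi> (2 * M j - x - ?t))
          + (1 - ?r j) * q (j + 1) (\<lambda>x. \<phi> (x - ?t))"
        using law_q[OF Suc.prems(1) jn(1)] D_left test_functions_mono by blast
      also have "p j (\<lambda>x. \<phi> (2 * M j - x - ?t)) = ?v (2 * j - 1) * \<phi> (X j)"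
      proof -
        have "(\<lambda>x. \<phi> (2 * X j - x)) \<in> ?D (X j)"
          using test_functions_reflect[OF Suc.prems(3), of "2 * X j"] by simp
        from pIH[OF Suc.prems(1,2) this] show ?thesis
          by (simp add: \<tau>_Suc M_eq algebra_simps)
      qed
      also have "q (j + 1) (\<lambda>x. \<phi> (x - ?t)) = ?v (2 * (j + 1)) * \<phi> (X j)"
      proof -
        have "(\<lambda>x. \<phi> (x - h)) \<in> ?D (X (j + 1))"
          using test_functions_shift[OF Suc.prems(3), of "- h"] unfolding X_Suc by simp
        from qIH[OF jn(3,2) this] show ?thesis unfolding X_Suc \<tau>_Suc by (simp add: diff_diff_eq)
      qed
      finally show ?thesis
        unfolding scatter_v_left_Suc[OF jn(1)] by (simp add: algebra_simps)
    qed
    ultimately show ?case ..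
  qed
  have "u (\<tau> k) \<phi> = scatter_u z A B a b n k j * \<phi> (X j)" if "\<phi> \<in> ?D (X j)" for \<phi>
    using up[OF j test_functions_mono[OF that ball_layer] \<tau>_nonneg[of k]] waves[OF j that, of k]
    by (simp add: scatter_u_def distrib_right)
  then show ?thesis unfolding dirac_part_at_def using h_pos by (meson half_gt_zero)
qed

end

section \<open>The step impedance and the algorithm\<close>

text \<open>Apart from the grid points, the algorithm samples \<open>\<alpha>\<close> to the left of the grid and \<open>\<beta>\<close> to the right
  of it. The impedance enters only through the reflection coefficients.\<close>

lemma scatter_u_cong:
  assumes "\<And>j. 1 \<le> j \<Longrightarrow> j \<le> n \<Longrightarrow> refl_coef z a b n j = refl_coef z' a b n j"
    and "\<And>j. 1 \<le> j \<Longrightarrow> j \<le> n + 1 \<Longrightarrow> \<alpha> (grid_pt a b n j) = \<alpha>' (grid_pt a b n j)"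
    and "\<And>j. 1 \<le> j \<Longrightarrow> j \<le> n + 1 \<Longrightarrow> \<beta> (grid_pt a b n j) = \<beta>' (grid_pt a b n j)"
    and "\<And>k. \<alpha> (grid_pt a b n 1 - grid_time a b n k) = \<alpha>' (grid_pt a b n 1 - grid_time a b n k)"
    and "\<And>k. \<beta> (grid_pt a b n (n + 1) + grid_time a b n k) =
             \<beta>' (grid_pt a b n (n + 1) + grid_time a b n k)"
    and j: "1 \<le> j" "j \<le> n + 1"
  shows "scatter_u z \<alpha> \<beta> a b n k j = scatter_u z' \<alpha>' \<beta>' a b n k j"
proof -
  let ?v = "scatter_v z' \<alpha>' \<beta>' a b n"
  have "scatter_v z \<alpha> \<beta> a b n k (2 * j - 1) = ?v k (2 * j - 1) \<and>
      scatter_v z \<alpha> \<beta> a b n k (2 * j) = ?v k (2 * j)"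
    by (rule scatter_v_eqI[where P = "\<lambda>k j. ?v k (2 * j - 1)" and Q = "\<lambda>k j. ?v k (2 * j)"])
      (use assms scatter_v_right_boundary[of z' \<alpha>' \<beta>' a b n] in
        \<open>simp_all only: scatter_v_right_0 scatter_v_left_0 scatter_v_left_boundary
          scatter_v_right_Suc scatter_v_left_Suc, simp_all\<close>)
  then show ?thesis by (simp add: scatter_u_def)
qed

lemma mid_pt_eq: "mid_pt a b n j = a + (real j - 1 / 2) * mesh a b n"
  by (simp add: mid_pt_def grid_pt_def field_simps)

lemma mid_pt_mono: "a < b \<Longrightarrow> i \<le> j \<Longrightarrow> mid_pt a b n i \<le> mid_pt a b n j"
  unfolding mid_pt_eq by (intro add_left_mono mult_right_mono) (simp_all add: mesh_def)

lemma step_impedance_outer: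
  assumes "a < b" "1 \<le> n"
  shows "x < mid_pt a b n 1 \<Longrightarrow> step_impedance \<zeta> \<zeta>m \<zeta>p a b n x = \<zeta>m"
    and "mid_pt a b n n \<le> x \<Longrightarrow> step_impedance \<zeta> \<zeta>m \<zeta>p a b n x = \<zeta>p"
  using mid_pt_mono[OF assms, of n] by (simp_all add: step_impedance_def del: One_nat_def)

lemma step_impedance_inner:
  assumes "a < b" and j: "2 \<le> j" "j \<le> n" and x: "mid_pt a b n (j - 1) \<le> x" "x < mid_pt a b n j"
  shows "step_impedance \<zeta> \<zeta>m \<zeta>p a b n x = \<zeta> (grid_pt a b n j)"
proof -
  have mono: "i \<le> l \<Longrightarrow> mid_pt a b n i \<le> mid_pt a b n l" for i l
    using \<open>a < b\<close> by (rule mid_pt_mono)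
  have "\<not> x < mid_pt a b n 1" "\<not> mid_pt a b n n \<le> x"
    using x mono[of 1 "j - 1"] mono[of j n] j by linarith+
  moreover have "(THE i. 2 \<le> i \<and> i \<le> n \<and> mid_pt a b n (i - 1) \<le> x \<and> x < mid_pt a b n i) = j"
  proof (rule the_equality)
    fix i assume i: "2 \<le> i \<and> i \<le> n \<and> mid_pt a b n (i - 1) \<le> x \<and> x < mid_pt a b n i"
    then have "\<not> i \<le> j - 1" "\<not> j \<le> i - 1" using mono[of i "j - 1"] mono[of j "i - 1"] x by linarith+
    then show "i = j" by linarith
  qed (use j x in auto)
  ultimately show ?thesis unfolding step_impedance_def by simp
qed

lemma layered_medium_step_impedance:
  assumes ab: "a < b" and n: "1 \<le> n" and pos: "\<And>x. 0 < \<zeta> x"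
    and agree: "\<And>j. 1 \<le> j \<Longrightarrow> j \<le> n + 1 \<Longrightarrow>
      step_impedance \<zeta> \<zeta>m \<zeta>p a b n (grid_pt a b n j) = \<zeta> (grid_pt a b n j)"
  shows "layered_medium a b n (step_impedance \<zeta> \<zeta>m \<zeta>p a b n)"
proof
  let ?z = "step_impedance \<zeta> \<zeta>m \<zeta>p a b n"
  fix j x assume j: "1 \<le> j" "j \<le> n + 1" and x: "x \<in> layer a b n j"
  have "grid_pt a b n j \<in> layer a b n j"
    using ab n by (auto simp: layer_def mid_pt_eq grid_pt_def mesh_def of_nat_diff field_simps)
  consider "j = 1" | "j = n + 1" | "2 \<le> j" "j \<le> n" using j by linarith
  then have const: "\<exists>c. \<forall>y\<in>layer a b n j. ?z y = c"
  proof cases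
    case 1
    then have "\<forall>y\<in>layer a b n j. ?z y = \<zeta>m"
      using n by (auto simp: layer_def step_impedance_outer(1)[OF ab n])
    then show ?thesis ..
  next
    case 2
    then have "\<forall>y\<in>layer a b n j. ?z y = \<zeta>p"
      using n by (auto simp: layer_def step_impedance_outer(2)[OF ab n])
    then show ?thesis ..
  next
    case 3
    then have "\<forall>y\<in>layer a b n j. ?z y = \<zeta> (grid_pt a b n j)"
      by (auto simp: layer_def step_impedance_inner[OF ab])
    then show ?thesis ..
  qed
  with x \<open>grid_pt a b n j \<in> layer a b n j\<close> show "?z x = ?z (grid_pt a b n j)" by metis
qed (use assms in auto)

theorem theorem2:
  fixes \<zeta> zP :: "real \<Rightarrow> real" and lo hi \<zeta>m \<zeta>p xm xp a b T :: real and n :: nat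
  assumes bounds: "0 < lo" "lo < hi" "\<forall>x. lo < \<zeta> x \<and> \<zeta> x < hi"
    and outer: "xm < xp" "\<forall>x<xm. \<zeta> x = \<zeta>m" "\<forall>x>xp. \<zeta> x = \<zeta>p"
    and interval: "{xm..xp} \<subseteq> {a..b}"
    and n: "n \<ge> 1" and T: "T > 0"
    and zP: "zP = step_impedance \<zeta> \<zeta>m \<zeta>p a b n"
    and agree: "\<forall>j\<in>{1..n+1}. zP (grid_pt a b n j) = \<zeta> (grid_pt a b n j)"
  shows
    "(\<forall>f g. (\<forall>x. (\<lambda>s. \<zeta> s * g s) integrable_on {..x}) \<longrightarrow>
        (\<forall>u. wave_solution zP a b n (right_part \<zeta> f g) (left_part \<zeta> f g) u \<longrightarrow>
           (\<forall>j\<in>{1..n+1}. \<forall>k\<in>{0..num_steps a b n T}.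
              u (grid_pt a b n j) (grid_time a b n k) =
              scatter_u \<zeta> (right_part \<zeta> f g) (left_part \<zeta> f g) a b n k j)) \<and>
        (\<forall>u. ivp_solution zP a b n f g u \<longrightarrow>
           (\<forall>j\<in>{1..n+1}. \<forall>k\<in>{0..num_steps a b n T}.
              u (grid_pt a b n j) (grid_time a b n k) =
              scatter_u \<zeta> (right_part zP f g) (left_part zP f g) a b n k j) \<and>
           ((\<forall>i\<in>{1..n+1}. integral {..grid_pt a b n i} (\<lambda>s. \<zeta> s * g s) =
                           integral {..grid_pt a b n i} (\<lambda>s. zP s * g s)) \<longrightarrow>
            (\<forall>j\<in>{1..n+1}. \<forall>k\<in>{0..num_steps a b n T}.
              u (grid_pt a b n j) (grid_time a b n k) =
              scatter_u \<zeta> (right_part \<zeta> f g) (left_part \<zeta> f g) a b n k j))))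
     \<and>
     (\<forall>c d :: int \<Rightarrow> real. \<forall>A B :: real \<Rightarrow> real. \<forall>u.
        (\<forall>i. A (a + of_int i * mesh a b n) = c i) \<and>
        (\<forall>i. B (a + of_int i * mesh a b n) = d i) \<and>
        wave_solution_dist zP a b n
          (dirac_comb c a (mesh a b n)) (dirac_comb d a (mesh a b n)) u \<longrightarrow>
        (\<forall>j\<in>{1..n+1}. \<forall>k\<in>{0..num_steps a b n T}.
           dirac_part_at (u (grid_time a b n k)) (grid_pt a b n j)
             (scatter_u \<zeta> A B a b n k j)))"
proof -
  have "xm \<in> {a..b}" "xp \<in> {a..b}" using interval outer(1) by auto
  then have xm: "a \<le> xm" and xp: "xp \<le> b" and ab: "a < b" using outer(1) by auto
  have pos: "0 < \<zeta> x" for x using bounds order.strict_trans by blast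
  interpret layered_medium a b n zP
    unfolding zP using agree pos
    by (intro layered_medium_step_impedance[OF ab n]) (auto simp: zP)
  have zP_grid: "zP (X j) = \<zeta> (X j)" if "1 \<le> j" "j \<le> n + 1" for j
    using agree that by simp
  have refl: "refl_coef zP a b n j = refl_coef \<zeta> a b n j" if "1 \<le> j" "j \<le> n" for j
    using zP_grid[of j] zP_grid[of "j + 1"] that by (simp add: refl_coef_def)
  \<comment> \<open>Outside \<open>[a,b]\<close> both impedances have their outer constant value; at the end point \<open>b\<close>, where
    \<open>xp\<close> may lie, the agreement on the grid takes over.\<close>
  have left: "zP x = \<zeta> x" if "x < a" for x
  proof -
    have "x < M 1" using that h_pos X_1 by (simp add: M_eq)
    then show ?thesis using step_impedance_outer(1)[OF ab n] outer(2) that xm by (simp add: zP)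
  qed
  have right: "zP x = \<zeta> x" if "b \<le> x" for x
  proof (cases "x = b")
    case True
    then show ?thesis using zP_grid[of "n + 1"] X_last by simp
  next
    case False
    have "M n \<le> x" using that h_pos X_last X_Suc[of n] by (simp add: M_eq)
    then show ?thesis
      using step_impedance_outer(2)[OF ab n] outer(3) that xp False by (simp add: zP)
  qed
  have wave: "u (X j) (\<tau> k) = scatter_u \<zeta> \<alpha> \<beta> a b n k j"
    if "wave_solution zP a b n \<alpha> \<beta> u" "j \<in> {1..n+1}" for u \<alpha> \<beta> j k
    using wave_solution_at_grid[OF that(1)] that(2) scatter_u_cong[OF refl, of \<alpha> \<alpha> \<beta> \<beta> j k] by simp
  have ivp: "u (X j) (\<tau> k) = scatter_u \<zeta> (right_part zP f g) (left_part zP f g) a b n k j"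
    and ivp': "(\<forall>i\<in>{1..n+1}. integral {..X i} (\<lambda>s. \<zeta> s * g s) = integral {..X i} (\<lambda>s. zP s * g s)) \<Longrightarrow>
      u (X j) (\<tau> k) = scatter_u \<zeta> (right_part \<zeta> f g) (left_part \<zeta> f g) a b n k j"
    if int: "\<forall>x. (\<lambda>s. \<zeta> s * g s) integrable_on {..x}" and u: "ivp_solution zP a b n f g u"
      and j: "j \<in> {1..n+1}" for f g u j k
  proof -
    have left_int: "integral {..x} (\<lambda>s. zP s * g s) = integral {..x} (\<lambda>s. \<zeta> s * g s)"
      and far_left: "(\<lambda>s. zP s * g s) integrable_on {..x}" if "x < a" for x
    proof -
      have eq: "\<zeta> s * g s = zP s * g s" if "s \<in> {..x}" for s using left[of s] that \<open>x < a\<close> by simp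
      show "integral {..x} (\<lambda>s. zP s * g s) = integral {..x} (\<lambda>s. \<zeta> s * g s)"
        by (rule integral_cong) (rule eq[symmetric])
      show "(\<lambda>s. zP s * g s) integrable_on {..x}"
        using int eq by (blast intro: integrable_eq)
    qed
    show zP_parts: "u (X j) (\<tau> k) = scatter_u \<zeta> (right_part zP f g) (left_part zP f g) a b n k j"
      using wave[OF ivp_solution_imp_wave_solution[OF u far_left] j] .
    assume eq: "\<forall>i\<in>{1..n+1}. integral {..X i} (\<lambda>s. \<zeta> s * g s) = integral {..X i} (\<lambda>s. zP s * g s)"
    \<comment> \<open>Agreement of the integrals at the last grid point \<open>b\<close> carries over to the right of it.\<close>
    have right_int: "integral {..x} (\<lambda>s. zP s * g s) = integral {..x} (\<lambda>s. \<zeta> s * g s)" if "b \<le> x" for x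
    proof -
      have cong: "zP s * g s = \<zeta> s * g s" if "s \<in> {b..x}" for s using right that by simp
      have split: "integral {..x} w = integral {..b} w + integral {b..x} w"
        if "\<And>y. w integrable_on {..y}" for w :: "real \<Rightarrow> real"
      proof -
        have "w integrable_on {b..x}"
          by (rule integrable_on_subinterval[OF that[of x]]) auto
        then have "(w has_integral integral {..b} w + integral {b..x} w) {..x}"
          using \<open>b \<le> x\<close>
          by (rule has_integral_extend_right[OF integrable_integral[OF that] integrable_integral])
        then show ?thesis by (rule integral_unique)
      qed
      have "integral {..b} (\<lambda>s. zP s * g s) = integral {..b} (\<lambda>s. \<zeta> s * g s)"
        using eq X_last by (metis atLeastAtMost_iff le_add2 order_refl)
      moreover have "integral {b..x} (\<lambda>s. zP s * g s) = integral {b..x} (\<lambda>s. \<zeta> s * g s)"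
        by (rule integral_cong) (rule cong)
      ultimately show ?thesis
        using split[OF ivp_solution_integrable[OF u far_left]] split int by simp
    qed
    have parts: "right_part zP f g x = right_part \<zeta> f g x \<and> left_part zP f g x = left_part \<zeta> f g x"
      if "zP x = \<zeta> x" "integral {..x} (\<lambda>s. zP s * g s) = integral {..x} (\<lambda>s. \<zeta> s * g s)" for x
      using that by (simp add: right_part_def left_part_def)
    have grid: "right_part zP f g (X i) = right_part \<zeta> f g (X i) \<and>
        left_part zP f g (X i) = left_part \<zeta> f g (X i)" if "1 \<le> i" "i \<le> n + 1" for i
      using parts[OF zP_grid[OF that]] eq that by simp
    have "scatter_u \<zeta> (right_part zP f g) (left_part zP f g) a b n k j =
        scatter_u \<zeta> (right_part \<zeta> f g) (left_part \<zeta> f g) a b n k j"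
    proof (rule scatter_u_cong)
      fix i
      show "right_part zP f g (X 1 - \<tau> i) = right_part \<zeta> f g (X 1 - \<tau> i)"
      proof (cases i)
        case 0
        then show ?thesis using grid[of 1] by (simp add: \<tau>_0)
      next
        case (Suc i')
        then have "X 1 - \<tau> i < a" using \<tau>_nonneg[of i'] h_pos by (simp only: X_1 \<tau>_Suc)
        then show ?thesis using parts left left_int by blast
      qed
      have "b \<le> X (n + 1) + \<tau> i" using \<tau>_nonneg[of i] by (simp only: X_last)
      then show "left_part zP f g (X (n + 1) + \<tau> i) = left_part \<zeta> f g (X (n + 1) + \<tau> i)"
        using parts right right_int by blast
    qed (use grid j in auto)
    with zP_parts show "u (X j) (\<tau> k) = scatter_u \<zeta> (right_part \<zeta> f g) (left_part \<zeta> f g) a b n k j"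
      by simp
  qed
  have dirac: "dirac_part_at (u (\<tau> k)) (X j) (scatter_u \<zeta> A B a b n k j)"
    if "\<forall>i. A (a + of_int i * h) = c i" "\<forall>i. B (a + of_int i * h) = d i"
      "wave_solution_dist zP a b n (dirac_comb c a h) (dirac_comb d a h) u" "j \<in> {1..n+1}"
    for A B c d u j k
    using wave_solution_dist_at_grid[OF that(3), of A B j k] that
      scatter_u_cong[OF refl, of A A B B j k] by simp
  show ?thesis
    by (intro conjI allI impI ballI; (elim conjE)?; (rule wave ivp ivp' dirac; assumption))
qed

end
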